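(* Let $k\ge1$, let $\alpha_1,\dots,\alpha_k\colon\mathbb{F}^\times\to\mathbb{C}^\times$ be characters and $\alpha=\alpha_1\times\dots\times\alpha_k$. Let $c_1,c_2\ge1$. If $h_1\in\mathrm{GL}_{c_1}(\mathbb{F})$ and $h_2\in\mathrm{GL}_{c_2}(\mathbb{F})$ have no common eigenvalues over the algebraic closure $\overline{\mathbb{F}}$, then for $h=\mathrm{diag}(h_1,h_2)$ we have $$\mathrm{Kl}(\alpha,\psi,h)=q^{(k-1)c_1c_2}\cdot\mathrm{Kl}(\alpha,\psi,h_1)\cdot\mathrm{Kl}(\alpha,\psi,h_2).$$
   Context: $\mathbb{F}$ is a finite field with $q$ elements and $\psi\colon\mathbb{F}\to\mathbb{C}^\times$ is a fixed non-trivial additive character. For characters $\alpha_1,\dots,\alpha_k$ of $\mathbb{F}^\times$, $\alpha=\alpha_1\times\dots\times\alpha_k\colon(\mathbb{F}^\times)^k\to\mathbb{C}^\times$, and $h\in\mathrm{GL}_c(\mathbb{F})$ ($c\ge1$), the twisted matrix Kloosterman sum is $$\mathrm{Kl}(\alpha,\psi,h)=\sum_{\substack{x_1,\dots,x_k\in\mathrm{GL}_c(\mathbb{F})\\ x_1\cdots x_k=h}}\Big(\prod_{j=1}^k\alpha_j(\det x_j)\Big)\psi\Big(\sum_{j=1}^k\mathrm{tr}\,x_j\Big).$$ *)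

theory Defs
  imports
    "Jordan_Normal_Form.Char_Poly"
    "HOL-Algebra.Algebraic_Closure_Type"
    "HOL-Library.Cardinality"
    Complex_Main
begin

text \<open>The finite field is a type of class \<open>{finite, field}\<close>; its cardinality \<open>q\<close> is \<open>CARD('a)\<close>.\<close>

definition additive_character :: "('a :: field \<Rightarrow> complex) \<Rightarrow> bool" where
  "additive_character \<psi> \<longleftrightarrow> (\<forall>x. \<psi> x \<noteq> 0) \<and> (\<forall>x y. \<psi> (x + y) = \<psi> x * \<psi> y)"

definition nontrivial_additive_character :: "('a :: field \<Rightarrow> complex) \<Rightarrow> bool" where
  "nontrivial_additive_character \<psi> \<longleftrightarrow> additive_character \<psi> \<and> (\<exists>x. \<psi> x \<noteq> 1)"

text \<open>A character of the unit group is represented by a total function on the field whose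
  value at \<open>0\<close> is arbitrary; below it is only evaluated at determinants of invertible matrices.\<close>

definition multiplicative_character :: "('a :: field \<Rightarrow> complex) \<Rightarrow> bool" where
  "multiplicative_character \<chi> \<longleftrightarrow>
     (\<forall>x. x \<noteq> 0 \<longrightarrow> \<chi> x \<noteq> 0) \<and>
     (\<forall>x y. x \<noteq> 0 \<longrightarrow> y \<noteq> 0 \<longrightarrow> \<chi> (x * y) = \<chi> x * \<chi> y)"

definition GL :: "nat \<Rightarrow> 'a :: field mat set" where
  "GL c = {A \<in> carrier_mat c c. invertible_mat A}"

definition mat_trace :: "'a :: comm_monoid_add mat \<Rightarrow> 'a" where
  "mat_trace A = (\<Sum>i<dim_row A. A $$ (i, i))"

definition mat_list_prod :: "nat \<Rightarrow> 'a :: semiring_1 mat list \<Rightarrow> 'a mat" where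
  "mat_list_prod c xs = foldr (*) xs (1\<^sub>m c)"

definition kloosterman_tuples :: "nat \<Rightarrow> 'a :: field mat \<Rightarrow> 'a mat list set" where
  "kloosterman_tuples k h =
     {xs. length xs = k \<and> set xs \<subseteq> GL (dim_row h) \<and> mat_list_prod (dim_row h) xs = h}"

text \<open>Tuples are indexed from \<open>0\<close>: the characters are \<open>\<alpha> 0, \<dots>, \<alpha> (k - 1)\<close>, and the
  values of \<open>\<alpha>\<close> at indices \<open>\<ge> k\<close> play no role. The matrix size is read off from \<open>h\<close>.\<close>

definition Kl :: "nat \<Rightarrow> (nat \<Rightarrow> 'a \<Rightarrow> complex) \<Rightarrow> ('a \<Rightarrow> complex) \<Rightarrow> 'a :: {finite, field} mat \<Rightarrow> complex" where
  "Kl k \<alpha> \<psi> h =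
     (\<Sum>xs \<in> kloosterman_tuples k h.
        (\<Prod>j<k. \<alpha> j (det (xs ! j))) * \<psi> (\<Sum>j<k. mat_trace (xs ! j)))"

text \<open>The index set in \<open>Kl\<close> is finite, so the convention that sums over infinite sets are \<open>0\<close> never applies.\<close>

lemma finite_carrier_mat: "finite (carrier_mat m n :: 'a :: finite mat set)"
proof -
  have "carrier_mat m n \<subseteq> (\<lambda>f. mat m n (\<lambda>p. f p) :: 'a mat) ` (PiE ({..<m} \<times> {..<n}) (\<lambda>_. UNIV))"
  proof
    fix A :: "'a mat" assume A: "A \<in> carrier_mat m n"
    have "A = mat m n (\<lambda>p. restrict (\<lambda>p. A $$ p) ({..<m} \<times> {..<n}) p)"
      using A by (intro eq_matI) auto
    moreover have "restrict (\<lambda>p. A $$ p) ({..<m} \<times> {..<n}) \<in> PiE ({..<m} \<times> {..<n}) (\<lambda>_. UNIV)"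
      by auto
    ultimately show "A \<in> (\<lambda>f. mat m n (\<lambda>p. f p)) ` (PiE ({..<m} \<times> {..<n}) (\<lambda>_. UNIV))"
      by blast
  qed
  moreover have "finite (PiE ({..<m} \<times> {..<n}) (\<lambda>_. UNIV :: 'a set))"
    by (intro finite_PiE) auto
  ultimately show ?thesis
    by (meson finite_imageI finite_subset)
qed

lemma finite_kloosterman_tuples: "finite (kloosterman_tuples k (h :: 'a :: {finite, field} mat))"
proof (rule finite_subset)
  show "kloosterman_tuples k h \<subseteq>
      {xs. set xs \<subseteq> carrier_mat (dim_row h) (dim_row h) \<and> length xs = k}"
    by (auto simp: kloosterman_tuples_def GL_def)
  show "finite {xs. set xs \<subseteq> (carrier_mat (dim_row h) (dim_row h) :: 'a mat set) \<and> length xs = k}"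
    by (intro finite_lists_length_eq finite_carrier_mat)
qed

end

theory Submission
  imports Defs
begin

text \<open>
  Put \<open>f\<^sub>j(x) = \<alpha>\<^sub>j(det x) \<psi>(tr x)\<close>, so that \<open>Kl\<close> is the convolution \<open>f\<^sub>1 * \<dots> * f\<^sub>k\<close> on
  \<open>GL\<^sub>c\<close> with \<open>c = c\<^sub>1 + c\<^sub>2\<close>. Let \<open>P\<close> be the group of invertible block upper triangular matrices of
  type \<open>(c\<^sub>1, c\<^sub>2)\<close> and \<open>U\<close> its subgroup of matrices \<open>u(n) = (1, n; 0, 1)\<close>. The proof compares two
  evaluations of \<open>\<Sum>\<^sub>n Kl(h u(n))\<close> for \<open>h = diag(h\<^sub>1, h\<^sub>2)\<close>, a sum over all \<open>c\<^sub>1 \<times> c\<^sub>2\<close> matrices \<open>n\<close>.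

  The sum of one \<open>f\<^sub>j\<close> over a coset \<open>g U\<close> is easy. Only the trace depends on \<open>n\<close>, through
  \<open>tr(C n)\<close> where \<open>C\<close> is the lower left block of \<open>g\<close>, so orthogonality of characters kills the sum
  unless \<open>C = 0\<close>, that is \<open>g \<in> P\<close>, and then each of the \<open>q\<^bsup>c\<^sub>1c\<^sub>2\<^esup>\<close> terms is the product of the values of
  \<open>f\<^sub>j\<close> at the diagonal blocks (\<open>sum_twist_shear\<close>). This shape survives convolution: the sum of \<open>Kl\<close>
  over \<open>g U\<close> vanishes for \<open>g \<notin> P\<close>, and for \<open>g \<in> P\<close> with diagonal blocks \<open>A, D\<close> it equals
  \<open>q\<^bsup>k c\<^sub>1c\<^sub>2\<^esup> Kl(A) Kl(D)\<close> (\<open>sum_Kl_shear\<close>). The induction peels off the first factor of the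
  convolution. The inductive hypothesis confines the remaining factors to \<open>P\<close> and makes them invariant
  under \<open>U\<close>; as \<open>U\<close> is normal in \<open>P\<close>, the first factor is then itself summed over cosets of \<open>U\<close>.

  On the other hand \<open>Kl\<close> is a class function (\<open>Kl_conj\<close>), and every \<open>h u(n)\<close> is conjugate to \<open>h\<close>:
  conjugating \<open>h\<close> by \<open>u(x)\<close> produces the upper right block \<open>x h\<^sub>2 - h\<^sub>1 x\<close>, and this Sylvester operator is
  bijective because \<open>h\<^sub>1\<close> and \<open>h\<^sub>2\<close> have no common eigenvalue (\<open>sylvester_solvable\<close>). Hence the same
  sum is \<open>q\<^bsup>c\<^sub>1c\<^sub>2\<^esup> Kl(h)\<close>, and dividing by \<open>q\<^bsup>c\<^sub>1c\<^sub>2\<^esup>\<close> gives the theorem.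
\<close>

section \<open>Inverses in the general linear group\<close>

lemma GL_iff_det: "A \<in> GL c \<longleftrightarrow> A \<in> carrier_mat c c \<and> det (A :: 'a :: field mat) \<noteq> 0"
proof
  assume "A \<in> GL c"
  then obtain B where A: "A \<in> carrier_mat c c" and AB: "A * B = 1\<^sub>m c" and BA: "B * A = 1\<^sub>m (dim_row B)"
    by (auto simp: GL_def invertible_mat_def inverts_mat_def)
  have B: "B \<in> carrier_mat c c"
    using arg_cong[OF AB, of dim_col] arg_cong[OF BA, of dim_col] A by auto
  have "det A * det B = 1"
    using det_mult[OF A B] AB by simp
  with A show "A \<in> carrier_mat c c \<and> det A \<noteq> 0" by auto
next
  assume A: "A \<in> carrier_mat c c \<and> det A \<noteq> 0"
  then obtain B where "B \<in> carrier_mat c c" "B * A = 1\<^sub>m c" "A * B = 1\<^sub>m c"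
    using det_non_zero_imp_unit[of A c undefined] by (auto simp: Units_def ring_mat_simps)
  with A show "A \<in> GL c"
    by (auto simp: GL_def invertible_mat_def inverts_mat_def)
qed

lemma GL_carrier: "A \<in> GL c \<Longrightarrow> A \<in> carrier_mat c c"
  by (simp add: GL_def)

lemma GL_det: "A \<in> GL c \<Longrightarrow> det A \<noteq> 0"
  by (simp add: GL_iff_det)

lemma GL_one: "1\<^sub>m c \<in> GL c"
  by (simp add: GL_iff_det)

lemma GL_mult: "A \<in> GL c \<Longrightarrow> B \<in> GL c \<Longrightarrow> A * B \<in> GL c"
  by (auto simp: GL_iff_det det_mult)

lemma finite_GL: "finite (GL c :: 'a :: {finite, field} mat set)"
  by (rule finite_subset[OF _ finite_carrier_mat[of c c]]) (auto simp: GL_def)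

lemma GL_right_inverse_in_GL:
  assumes "A \<in> carrier_mat c c" "B \<in> carrier_mat c c" "A * B = 1\<^sub>m c"
  shows "A \<in> GL c" "B \<in> GL c"
  using assms det_mult[OF assms(1,2)] by (auto simp: GL_iff_det)

definition gl_inv :: "'a :: field mat \<Rightarrow> 'a mat" where
  "gl_inv A = (SOME B. B \<in> carrier_mat (dim_row A) (dim_row A) \<and> A * B = 1\<^sub>m (dim_row A))"

lemma
  assumes "A \<in> GL c"
  shows gl_inv_carrier: "gl_inv A \<in> carrier_mat c c"
    and gl_inv_right: "A * gl_inv A = 1\<^sub>m c"
proof -
  have A: "A \<in> carrier_mat c c" "det A \<noteq> 0" using assms by (auto simp: GL_iff_det)
  then obtain B where "B \<in> carrier_mat c c" "A * B = 1\<^sub>m c"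
    using det_non_zero_imp_unit[of A c undefined] by (auto simp: Units_def ring_mat_simps)
  with A have "gl_inv A \<in> carrier_mat c c \<and> A * gl_inv A = 1\<^sub>m c"
    unfolding gl_inv_def
    using someI[of "\<lambda>B. B \<in> carrier_mat (dim_row A) (dim_row A) \<and> A * B = 1\<^sub>m (dim_row A)" B] by auto
  then show "gl_inv A \<in> carrier_mat c c" "A * gl_inv A = 1\<^sub>m c" by auto
qed

lemma gl_inv_left: "A \<in> GL c \<Longrightarrow> gl_inv A * A = 1\<^sub>m c"
  by (rule mat_mult_left_right_inverse[OF GL_carrier gl_inv_carrier gl_inv_right])

lemma gl_inv_GL: "A \<in> GL c \<Longrightarrow> gl_inv A \<in> GL c"
  by (rule GL_right_inverse_in_GL(2)[OF GL_carrier gl_inv_carrier gl_inv_right])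

lemma GL_cancel_left:
  assumes "A \<in> GL c" "B \<in> carrier_mat c m"
  shows "gl_inv A * (A * B) = B" "A * (gl_inv A * B) = B"
  using assms gl_inv_carrier[OF assms(1)]
  by (simp_all add: GL_carrier gl_inv_left gl_inv_right flip: assoc_mult_mat[of _ c c _ c _ m])

lemma GL_cancel_right:
  assumes "A \<in> GL c" "B \<in> carrier_mat m c"
  shows "B * A * gl_inv A = B" "B * gl_inv A * A = B"
  using assms gl_inv_carrier[OF assms(1)] GL_carrier[OF assms(1)]
  by (simp_all add: gl_inv_left gl_inv_right assoc_mult_mat[of _ m c _ c _ c])

lemma GL_conj_cancel:
  assumes "p \<in> GL c" "w \<in> carrier_mat c c"
  shows "gl_inv p * (p * w * gl_inv p * p) = w"
proof -
  have "p * w * gl_inv p * p = p * w"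
    using assms GL_carrier[OF assms(1)] by (intro GL_cancel_right) auto
  then show ?thesis using assms by (simp only: GL_cancel_left)
qed

lemma gl_inv_unique:
  assumes "A \<in> carrier_mat c c" "B \<in> carrier_mat c c" "A * B = 1\<^sub>m c"
  shows "gl_inv A = B"
proof -
  have A: "A \<in> GL c" by (rule GL_right_inverse_in_GL(1)[OF assms])
  have "gl_inv A = gl_inv A * (A * B)"
    using gl_inv_carrier[OF A] by (simp add: assms(3))
  also have "\<dots> = B" using A assms(2) by (rule GL_cancel_left)
  finally show ?thesis .
qed

lemma gl_inv_gl_inv: "A \<in> GL c \<Longrightarrow> gl_inv (gl_inv A) = A"
  by (rule gl_inv_unique[OF gl_inv_carrier GL_carrier gl_inv_left])

lemma gl_inv_mult:
  assumes "A \<in> GL c" "B \<in> GL c"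
  shows "gl_inv (A * B) = gl_inv B * gl_inv A"
proof (rule gl_inv_unique)
  note c = GL_carrier[OF assms(1)] GL_carrier[OF assms(2)] gl_inv_carrier[OF assms(1)] gl_inv_carrier[OF assms(2)]
  show "A * B \<in> carrier_mat c c" "gl_inv B * gl_inv A \<in> carrier_mat c c" using c by auto
  have "A * B * (gl_inv B * gl_inv A) = A * (B * (gl_inv B * gl_inv A))"
    using c by (intro assoc_mult_mat) auto
  also have "\<dots> = 1\<^sub>m c"
    using assms c by (simp add: GL_cancel_left gl_inv_right)
  finally show "A * B * (gl_inv B * gl_inv A) = 1\<^sub>m c" .
qed

lemma bij_betw_GL_mult_left:
  assumes "A \<in> GL c"
  shows "bij_betw (\<lambda>z. A * z) (GL c) (GL c)"
  by (rule bij_betwI[where g = "\<lambda>z. gl_inv A * z"])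
     (use assms in \<open>auto intro: GL_mult gl_inv_GL simp: GL_cancel_left[OF _ GL_carrier]\<close>)

section \<open>Traces and Kloosterman sums as convolutions\<close>

lemma mat_trace_add:
  assumes "A \<in> carrier_mat c c" "B \<in> carrier_mat c c"
  shows "mat_trace (A + B) = mat_trace A + mat_trace (B :: 'a :: comm_monoid_add mat)"
  using assms by (simp add: mat_trace_def sum.distrib)

lemma mat_trace_mult:
  assumes "A \<in> carrier_mat m n" "B \<in> carrier_mat n m"
  shows "mat_trace (A * B) = (\<Sum>i<m. \<Sum>j<n. A $$ (i, j) * (B :: 'a :: semiring_0 mat) $$ (j, i))"
  using assms by (auto simp: mat_trace_def scalar_prod_def atLeast0LessThan intro!: sum.cong)

lemma mat_trace_commute:
  assumes "A \<in> carrier_mat m n" "B \<in> carrier_mat n m"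
  shows "mat_trace (A * B) = mat_trace (B * A :: 'a :: comm_semiring_0 mat)"
  unfolding mat_trace_mult[OF assms] mat_trace_mult[OF assms(2,1)]
  by (subst sum.swap) (simp add: mult.commute)

lemma mat_trace_four_block:
  assumes "A \<in> carrier_mat m m" "D \<in> carrier_mat n n"
  shows "mat_trace (four_block_mat A B C D) = mat_trace A + mat_trace (D :: 'a :: comm_monoid_add mat)"
proof -
  have "mat_trace (four_block_mat A B C D) = (\<Sum>i<m + n. four_block_mat A B C D $$ (i, i))"
    using assms by (simp add: mat_trace_def)
  also have "\<dots> = (\<Sum>i<m. four_block_mat A B C D $$ (i, i)) + (\<Sum>i<n. four_block_mat A B C D $$ (m + i, m + i))"
    by (induction n) (auto simp: add.assoc)
  also have "\<dots> = mat_trace A + mat_trace D"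
    using assms by (intro arg_cong2[where f = "(+)"]) (auto simp: mat_trace_def intro!: sum.cong)
  finally show ?thesis .
qed

text \<open>
  The convolution factors of a Kloosterman sum. They are class functions for all \<open>\<chi>\<close> and
  \<open>\<psi>\<close>.
\<close>

definition twist :: "('a :: field \<Rightarrow> complex) \<Rightarrow> ('a \<Rightarrow> complex) \<Rightarrow> 'a mat \<Rightarrow> complex" where
  "twist \<chi> \<psi> x = \<chi> (det x) * \<psi> (mat_trace x)"

lemma additive_character_0:
  assumes "additive_character \<psi>"
  shows "\<psi> 0 = 1"
proof -
  have "\<psi> 0 * \<psi> 0 = \<psi> 0 * 1" using assms by (metis additive_character_def add_0 mult_1_right)
  then show ?thesis using assms by (simp add: additive_character_def)
qed

lemma additive_character_add: "additive_character \<psi> \<Longrightarrow> \<psi> (x + y) = \<psi> x * \<psi> y"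
  by (simp add: additive_character_def)

lemma additive_character_sum:
  assumes "additive_character \<psi>"
  shows "\<psi> (\<Sum>i\<in>I. f i) = (\<Prod>i\<in>I. \<psi> (f i))"
  by (induction I rule: infinite_finite_induct)
     (auto simp: additive_character_0[OF assms] additive_character_add[OF assms])

lemma Kl_twist:
  assumes "additive_character \<psi>"
  shows "Kl k \<alpha> \<psi> h = (\<Sum>xs\<in>kloosterman_tuples k h. \<Prod>j<k. twist (\<alpha> j) \<psi> (xs ! j))"
  by (simp add: Kl_def twist_def prod.distrib additive_character_sum[OF assms])

lemma mat_list_prod_GL: "set xs \<subseteq> GL c \<Longrightarrow> mat_list_prod c xs \<in> GL c"
  by (induction xs) (auto simp: mat_list_prod_def GL_one GL_mult)

text \<open>
  The empty convolution is the unit of the group algebra. It makes \<open>k = 0\<close> a legitimate start for the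
  inductions below.
\<close>

lemma Kl_0:
  assumes "additive_character \<psi>" "h \<in> carrier_mat c c"
  shows "Kl 0 \<alpha> \<psi> h = (if h = 1\<^sub>m c then 1 else 0)"
proof -
  have "kloosterman_tuples 0 h = (if h = 1\<^sub>m c then {[]} else {})"
    using assms(2) by (auto simp: kloosterman_tuples_def mat_list_prod_def)
  then show ?thesis by (simp add: Kl_twist[OF assms(1)])
qed

text \<open>
  The recursion singles out the first factor \<open>x\<^sub>1 = h z\<close>. Parametrising by \<open>z\<close>, the inverse of the
  product of the other factors, keeps \<open>h\<close> out of the second factor of the summand; this is what allows
  sums over cosets \<open>h U\<close> to be interchanged with the convolution.
\<close>

lemma Kl_Suc:
  fixes h :: "'a :: {finite, field} mat"
  assumes \<psi>: "additive_character \<psi>" and h: "h \<in> GL c"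
  shows "Kl (Suc k) \<alpha> \<psi> h =
    (\<Sum>z\<in>GL c. twist (\<alpha> 0) \<psi> (h * z) * Kl k (\<lambda>j. \<alpha> (Suc j)) \<psi> (gl_inv z))"
proof -
  define S :: "('a mat \<times> 'a mat list) set" where "S = (SIGMA z:GL c. kloosterman_tuples k (gl_inv z))"
  have hc: "h \<in> carrier_mat c c" using h by (rule GL_carrier)
  have dim: "dim_row (gl_inv z) = c" if "z \<in> GL c" for z :: "'a mat"
    using gl_inv_carrier[OF that] by auto
  have "(\<Sum>z\<in>GL c. twist (\<alpha> 0) \<psi> (h * z) * Kl k (\<lambda>j. \<alpha> (Suc j)) \<psi> (gl_inv z))
      = (\<Sum>z\<in>GL c. \<Sum>ys\<in>kloosterman_tuples k (gl_inv z).
           twist (\<alpha> 0) \<psi> (h * z) * (\<Prod>j<k. twist (\<alpha> (Suc j)) \<psi> (ys ! j)))"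
    by (simp add: Kl_twist[OF \<psi>] sum_distrib_left)
  also have "\<dots> = (\<Sum>(z, ys)\<in>S. twist (\<alpha> 0) \<psi> (h * z) * (\<Prod>j<k. twist (\<alpha> (Suc j)) \<psi> (ys ! j)))"
    unfolding S_def by (rule sum.Sigma) (auto simp: finite_GL finite_kloosterman_tuples)
  also have "\<dots> = (\<Sum>xs\<in>kloosterman_tuples (Suc k) h. \<Prod>j<Suc k. twist (\<alpha> j) \<psi> (xs ! j))"
  proof (rule sum.reindex_bij_witness[where i = "\<lambda>xs. (gl_inv h * hd xs, tl xs)"
        and j = "\<lambda>(z, ys). (h * z) # ys"], goal_cases)
    case (1 p)
    then show ?case using h by (auto simp: S_def GL_cancel_left[OF _ GL_carrier])
  next
    case (2 p)
    then obtain z ys where p: "p = (z, ys)" and z: "z \<in> GL c" and ys: "length ys = k" "set ys \<subseteq> GL c"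
      "mat_list_prod c ys = gl_inv z"
      using dim by (auto simp: S_def kloosterman_tuples_def)
    have "h * z * gl_inv z = h" using z hc by (rule GL_cancel_right)
    with ys z h p hc show ?case
      by (auto simp: kloosterman_tuples_def mat_list_prod_def GL_mult)
  next
    case (3 xs)
    then obtain x ys where xs: "xs = x # ys" and "x \<in> GL c"
      using hc by (cases xs) (auto simp: kloosterman_tuples_def)
    then show ?case using GL_cancel_left(2)[OF h GL_carrier] by simp
  next
    case (4 xs)
    then obtain x ys where xs: "xs = x # ys" and x: "x \<in> GL c" and ys: "length ys = k" "set ys \<subseteq> GL c"
      and prod: "x * mat_list_prod c ys = h"
      using hc by (cases xs) (auto simp: kloosterman_tuples_def mat_list_prod_def)
    have Y: "mat_list_prod c ys \<in> GL c" using ys by (intro mat_list_prod_GL)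
    have "gl_inv (gl_inv h * x) = gl_inv x * h"
      using gl_inv_mult[OF gl_inv_GL[OF h] x] gl_inv_gl_inv[OF h] by simp
    also have "\<dots> = mat_list_prod c ys"
      unfolding prod[symmetric] using x GL_carrier[OF Y] by (rule GL_cancel_left)
    finally have inv: "gl_inv (gl_inv h * x) = mat_list_prod c ys" .
    have "gl_inv h * x \<in> GL c" using gl_inv_GL[OF h] x by (rule GL_mult)
    then show ?case
      using xs ys GL_carrier[OF Y] by (auto simp: S_def kloosterman_tuples_def inv)
  next
    case (5 p)
    then show ?case by (auto simp: S_def prod.lessThan_Suc_shift simp del: prod.lessThan_Suc)
  qed
  also have "\<dots> = Kl (Suc k) \<alpha> \<psi> h" by (simp add: Kl_twist[OF \<psi>])
  finally show ?thesis by simp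
qed

lemma twist_conj:
  assumes "p \<in> GL c" "x \<in> carrier_mat c c"
  shows "twist \<chi> \<psi> (p * x * gl_inv p) = twist \<chi> \<psi> x"
proof -
  note c = assms(2) GL_carrier[OF assms(1)] gl_inv_carrier[OF assms(1)]
  have "det (gl_inv p) * det p = 1"
    using det_mult[OF c(3,2)] gl_inv_left[OF assms(1)] by simp
  then have "det (p * x * gl_inv p) = det x"
    using c by (simp add: det_mult[of _ c] mult.commute mult.left_commute)
  moreover have "mat_trace (p * x * gl_inv p) = mat_trace (gl_inv p * (p * x))"
    using c by (intro mat_trace_commute) auto
  ultimately show ?thesis using assms by (simp add: twist_def GL_cancel_left)
qed

text \<open>
  A convolution of class functions is a class function: in \<open>Kl_Suc\<close> the summation variable can be
  conjugated along with \<open>h\<close>.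
\<close>

lemma Kl_conj:
  assumes \<psi>: "additive_character \<psi>" and p: "p \<in> GL c" and h: "h \<in> GL c"
  shows "Kl k \<alpha> \<psi> (p * h * gl_inv p) = Kl k \<alpha> \<psi> h"
  using h
proof (induction k arbitrary: \<alpha> h)
  case (0 h)
  note c = GL_carrier[OF 0] GL_carrier[OF p] gl_inv_carrier[OF p]
  have "h = 1\<^sub>m c" if "p * h * gl_inv p = 1\<^sub>m c"
  proof -
    have "h = gl_inv p * (p * h * gl_inv p * p)"
      using GL_conj_cancel[OF p c(1)] by simp
    also have "\<dots> = 1\<^sub>m c" using c p by (simp add: that gl_inv_left)
    finally show ?thesis .
  qed
  then have "p * h * gl_inv p = 1\<^sub>m c \<longleftrightarrow> h = 1\<^sub>m c"
    using c p by (auto simp: gl_inv_right)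
  then show ?case using c by (simp add: Kl_0[OF \<psi>, of _ c])
next
  case (Suc k \<alpha> h)
  note c = GL_carrier[OF Suc.prems] GL_carrier[OF p] gl_inv_carrier[OF p]
  let ?\<phi> = "\<lambda>w. p * w * gl_inv p"
  have GL: "?\<phi> w \<in> GL c" if "w \<in> GL c" for w
    using p that by (intro GL_mult gl_inv_GL)
  have bij: "bij_betw ?\<phi> (GL c) (GL c)"
  proof (rule bij_betwI[where g = "\<lambda>w. gl_inv p * (w * p)"])
    show "?\<phi> \<in> GL c \<rightarrow> GL c" using GL by auto
    show "(\<lambda>w. gl_inv p * (w * p)) \<in> GL c \<rightarrow> GL c" using p by (auto intro!: GL_mult gl_inv_GL)
    show "gl_inv p * (?\<phi> w * p) = w" if "w \<in> GL c" for w
      using p GL_carrier[OF that] by (rule GL_conj_cancel)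
    show "?\<phi> (gl_inv p * (w * p)) = w" if "w \<in> GL c" for w
    proof -
      have "w * p \<in> carrier_mat c c" using GL_carrier[OF that] c by simp
      then have "p * (gl_inv p * (w * p)) = w * p" by (rule GL_cancel_left[OF p])
      then show ?thesis using GL_cancel_right(1)[OF p GL_carrier[OF that]] by simp
    qed
  qed
  have "Kl (Suc k) \<alpha> \<psi> (?\<phi> h) = (\<Sum>w\<in>GL c. twist (\<alpha> 0) \<psi> (?\<phi> h * ?\<phi> w) *
      Kl k (\<lambda>j. \<alpha> (Suc j)) \<psi> (gl_inv (?\<phi> w)))"
    unfolding Kl_Suc[OF \<psi> GL[OF Suc.prems]] by (rule sum.reindex_bij_betw[OF bij, symmetric])
  also have "\<dots> = (\<Sum>w\<in>GL c. twist (\<alpha> 0) \<psi> (h * w) * Kl k (\<lambda>j. \<alpha> (Suc j)) \<psi> (gl_inv w))"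
  proof (rule sum.cong[OF refl])
    fix w :: "'a mat" assume w: "w \<in> GL c"
    note wc = GL_carrier[OF w]
    have "?\<phi> h * ?\<phi> w = p * h * (gl_inv p * ?\<phi> w)"
      using c wc by (intro assoc_mult_mat) auto
    also have "\<dots> = p * h * (w * gl_inv p)"
    proof -
      have "?\<phi> w = p * (w * gl_inv p)" using c wc by (intro assoc_mult_mat) auto
      moreover have "gl_inv p * (p * (w * gl_inv p)) = w * gl_inv p"
        using p c wc by (intro GL_cancel_left) auto
      ultimately show ?thesis by simp
    qed
    also have "\<dots> = p * h * w * gl_inv p"
      using c wc by (intro assoc_mult_mat[symmetric]) auto
    also have "\<dots> = ?\<phi> (h * w)" using c wc by (simp add: assoc_mult_mat[of _ c c _ c _ c])
    finally have 1: "?\<phi> h * ?\<phi> w = ?\<phi> (h * w)" .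
    have "gl_inv (?\<phi> w) = p * (gl_inv w * gl_inv p)"
      using p w by (simp only: gl_inv_mult[of _ c] GL_mult gl_inv_GL gl_inv_gl_inv[OF p])
    also have "\<dots> = ?\<phi> (gl_inv w)"
      using c gl_inv_carrier[OF w] by (intro assoc_mult_mat[symmetric]) auto
    finally have 2: "gl_inv (?\<phi> w) = ?\<phi> (gl_inv w)" .
    show "twist (\<alpha> 0) \<psi> (?\<phi> h * ?\<phi> w) * Kl k (\<lambda>j. \<alpha> (Suc j)) \<psi> (gl_inv (?\<phi> w)) =
        twist (\<alpha> 0) \<psi> (h * w) * Kl k (\<lambda>j. \<alpha> (Suc j)) \<psi> (gl_inv w)"
      unfolding 1 2 Suc.IH[OF gl_inv_GL[OF w]] using c wc by (simp add: twist_conj[OF p])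
  qed
  also have "\<dots> = Kl (Suc k) \<alpha> \<psi> h" by (rule Kl_Suc[OF \<psi> Suc.prems, symmetric])
  finally show ?case .
qed

section \<open>Block unipotent matrices\<close>

text \<open>
  These matrices form the unipotent radical \<open>U\<close> of the block upper triangular group.
\<close>

definition shear :: "nat \<Rightarrow> nat \<Rightarrow> 'a :: field mat \<Rightarrow> 'a mat" where
  "shear c d n = four_block_mat (1\<^sub>m c) n (0\<^sub>m d c) (1\<^sub>m d)"

lemma shear_carrier [simp]: "shear c d n \<in> carrier_mat (c + d) (c + d)"
  by (simp add: shear_def)

lemma four_block_mult_shear:
  assumes "A \<in> carrier_mat r c" "B \<in> carrier_mat r d" "C \<in> carrier_mat s c" "D \<in> carrier_mat s d"
    and "n \<in> carrier_mat c d"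
  shows "four_block_mat A B C D * shear c d n = four_block_mat A (A * n + B) C (C * n + D)"
  unfolding shear_def using assms
  by (subst mult_four_block_mat[OF assms(1-4) one_carrier_mat assms(5) zero_carrier_mat one_carrier_mat]) simp

lemma shear_mult_four_block:
  assumes "A \<in> carrier_mat c r" "B \<in> carrier_mat c s" "C \<in> carrier_mat d r" "D \<in> carrier_mat d s"
    and "n \<in> carrier_mat c d"
  shows "shear c d n * four_block_mat A B C D = four_block_mat (A + n * C) (B + n * D) C D"
  unfolding shear_def using assms
  by (subst mult_four_block_mat[OF one_carrier_mat assms(5) zero_carrier_mat one_carrier_mat assms(1-4)]) simp

lemma shear_mult:
  assumes "m \<in> carrier_mat c d" "n \<in> carrier_mat c d"
  shows "shear c d m * shear c d n = shear c d (m + n)"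
  using assms comm_add_mat[OF assms] by (simp add: shear_def[of c d m] four_block_mult_shear[of _ c c _ d _ d])
     (simp add: shear_def)

lemma shear_uminus_mult:
  assumes "n \<in> carrier_mat c d"
  shows "shear c d (- n) * shear c d n = 1\<^sub>m (c + d)" "shear c d n * shear c d (- n) = 1\<^sub>m (c + d)"
proof -
  have "- n + n = 0\<^sub>m c d" "n + - n = 0\<^sub>m c d" using assms by (auto intro!: eq_matI)
  then show "shear c d (- n) * shear c d n = 1\<^sub>m (c + d)" "shear c d n * shear c d (- n) = 1\<^sub>m (c + d)"
    using assms by (simp_all add: shear_mult) (simp_all add: shear_def)
qed

lemma det_shear: "n \<in> carrier_mat c d \<Longrightarrow> det (shear c d n) = 1"
  unfolding shear_def by (subst det_four_block_mat_lower_left_zero[of _ c _ d]) auto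

lemma shear_GL: "n \<in> carrier_mat c d \<Longrightarrow> shear c d n \<in> GL (c + d)"
  by (simp add: GL_iff_det det_shear)

lemma gl_inv_shear: "n \<in> carrier_mat c d \<Longrightarrow> gl_inv (shear c d n) = shear c d (- n)"
  by (rule gl_inv_unique[where c = "c + d"]) (auto simp: shear_uminus_mult)

lemma four_block_eq_iff:
  assumes "A \<in> carrier_mat r c" "B \<in> carrier_mat r d" "C \<in> carrier_mat s c" "D \<in> carrier_mat s d"
    and "A' \<in> carrier_mat r c" "B' \<in> carrier_mat r d" "C' \<in> carrier_mat s c" "D' \<in> carrier_mat s d"
  shows "four_block_mat A B C D = four_block_mat A' B' C' D' \<longleftrightarrow> A = A' \<and> B = B' \<and> C = C' \<and> D = D'"
proof
  assume eq: "four_block_mat A B C D = four_block_mat A' B' C' D'"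
  note e = arg_cong[OF eq, of "\<lambda>M. M $$ p" for p]
  have "A $$ (i, j) = A' $$ (i, j)" if "i < r" "j < c" for i j
    using e[of "(i, j)"] that assms by auto
  moreover have "B $$ (i, j) = B' $$ (i, j)" if "i < r" "j < d" for i j
    using e[of "(i, c + j)"] that assms by auto
  moreover have "C $$ (i, j) = C' $$ (i, j)" if "i < s" "j < c" for i j
    using e[of "(r + i, j)"] that assms by auto
  moreover have "D $$ (i, j) = D' $$ (i, j)" if "i < s" "j < d" for i j
    using e[of "(r + i, c + j)"] that assms by auto
  ultimately show "A = A' \<and> B = B' \<and> C = C' \<and> D = D'"
    using assms by (auto intro!: eq_matI)
qed auto

lemma four_block_upper_GL_iff:
  assumes "A \<in> carrier_mat c c" "B \<in> carrier_mat c d" "D \<in> carrier_mat d d"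
  shows "four_block_mat A B (0\<^sub>m d c) D \<in> GL (c + d) \<longleftrightarrow> A \<in> GL c \<and> D \<in> GL d"
  using assms by (auto simp: GL_iff_det det_four_block_mat_lower_left_zero[of _ c _ d])

section \<open>Character sums over cosets of the unipotent radical\<close>

lemma card_carrier_mat: "card (carrier_mat m n :: 'a :: finite mat set) = CARD('a) ^ (m * n)"
proof -
  have "bij_betw (mat m n) (PiE ({..<m} \<times> {..<n}) (\<lambda>_. UNIV :: 'a set)) (carrier_mat m n)"
  proof (rule bij_betwI[where g = "\<lambda>A. restrict (($$) A) ({..<m} \<times> {..<n})"])
    show "restrict (($$) (mat m n f)) ({..<m} \<times> {..<n}) = f"
      if "f \<in> PiE ({..<m} \<times> {..<n}) (\<lambda>_. UNIV :: 'a set)" for f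
      using that by (intro PiE_ext[OF _ that]) auto
  qed (auto intro!: eq_matI)
  from bij_betw_same_card[OF this] show ?thesis
    by (simp add: card_PiE card_cartesian_product)
qed

lemma bij_betw_carrier_mat_add:
  fixes a :: "'a :: ab_group_add mat"
  assumes "a \<in> carrier_mat m n"
  shows "bij_betw (\<lambda>x. a + x) (carrier_mat m n) (carrier_mat m n)"
  by (rule bij_betwI[where g = "\<lambda>x. - a + x"]) (use assms in \<open>auto intro!: eq_matI\<close>)

text \<open>
  The map \<open>n \<mapsto> \<psi>(tr(C n))\<close> is a character of the additive group of matrices, and it is nontrivial
  when \<open>C \<noteq> 0\<close> because the trace pairing is nondegenerate.
\<close>

lemma sum_additive_character_trace:
  fixes \<psi> :: "'a :: {finite, field} \<Rightarrow> complex"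
  assumes \<psi>: "nontrivial_additive_character \<psi>" and C: "C \<in> carrier_mat d c"
  shows "(\<Sum>n\<in>carrier_mat c d. \<psi> (mat_trace (C * n))) =
    (if C = 0\<^sub>m d c then of_nat CARD('a) ^ (c * d) else 0)"
proof (cases "C = 0\<^sub>m d c")
  case True
  have "additive_character \<psi>" using \<psi> by (simp add: nontrivial_additive_character_def)
  then have "\<psi> (mat_trace (C * n)) = 1" if "n \<in> carrier_mat c d" for n
    using that by (simp add: True mat_trace_def additive_character_0)
  then show ?thesis by (simp add: True card_carrier_mat)
next
  case False
  have add: "additive_character \<psi>" using \<psi> by (simp add: nontrivial_additive_character_def)
  obtain t where t: "\<psi> t \<noteq> 1" using \<psi> by (auto simp: nontrivial_additive_character_def)
  obtain i j where ij: "i < d" "j < c" "C $$ (i, j) \<noteq> 0"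
    using False C by (metis (no_types, lifting) carrier_matD eq_matI index_zero_mat)
  \<comment> \<open>A multiple of a matrix unit for which \<open>tr(C m) = t\<close>.\<close>
  define m where "m = mat c d (\<lambda>p. if p = (j, i) then t / C $$ (i, j) else 0)"
  have m: "m \<in> carrier_mat c d" by (simp add: m_def)
  have "mat_trace (C * m) = (\<Sum>a<d. if a = i then \<Sum>b<c. if b = j then t else 0 else 0)"
    unfolding mat_trace_mult[OF C m] using ij
    by (intro sum.cong refl) (auto simp: m_def if_distrib[of "\<lambda>x. _ * x"] sum.delta cong: if_cong intro!: sum.neutral)
  also have "\<dots> = t" using ij by (simp add: sum.delta)
  finally have tr: "mat_trace (C * m) = t" .
  let ?S = "\<Sum>n\<in>carrier_mat c d. \<psi> (mat_trace (C * n))"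
  \<comment> \<open>Translating by \<open>m\<close> multiplies the sum by \<open>\<psi> t \<noteq> 1\<close>.\<close>
  have "?S = (\<Sum>n\<in>carrier_mat c d. \<psi> (mat_trace (C * (m + n))))"
    by (rule sum.reindex_bij_betw[OF bij_betw_carrier_mat_add[OF m], symmetric])
  also have "\<dots> = (\<Sum>n\<in>carrier_mat c d. \<psi> t * \<psi> (mat_trace (C * n)))"
  proof (rule sum.cong[OF refl])
    fix n :: "'a mat" assume n: "n \<in> carrier_mat c d"
    have "C * (m + n) = C * m + C * n" using C m n by (rule mult_add_distrib_mat)
    then show "\<psi> (mat_trace (C * (m + n))) = \<psi> t * \<psi> (mat_trace (C * n))"
      using C m n by (simp add: mat_trace_add[of _ d] tr additive_character_add[OF add])
  qed
  also have "\<dots> = \<psi> t * ?S" by (rule sum_distrib_left[symmetric])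
  finally have "?S = 0" using t by (metis mult_cancel_right1)
  then show ?thesis using False by simp
qed

text \<open>
  Right multiplication by \<open>u(n)\<close> preserves the determinant and adds \<open>tr(C n)\<close> to the trace, so the
  sum is controlled by orthogonality of characters.
\<close>

lemma sum_twist_shear:
  fixes \<psi> :: "'a :: {finite, field} \<Rightarrow> complex"
  assumes \<psi>: "nontrivial_additive_character \<psi>" and \<chi>: "multiplicative_character \<chi>"
    and c: "A \<in> carrier_mat c c" "B \<in> carrier_mat c d" "C \<in> carrier_mat d c" "D \<in> carrier_mat d d"
    and g: "four_block_mat A B C D \<in> GL (c + d)"
  shows "(\<Sum>n\<in>carrier_mat c d. twist \<chi> \<psi> (four_block_mat A B C D * shear c d n)) =
    (if C = 0\<^sub>m d c then of_nat CARD('a) ^ (c * d) * twist \<chi> \<psi> A * twist \<chi> \<psi> D else 0)"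
proof -
  let ?g = "four_block_mat A B C D"
  have add: "additive_character \<psi>" using \<psi> by (simp add: nontrivial_additive_character_def)
  have "twist \<chi> \<psi> (?g * shear c d n) = \<chi> (det ?g) * \<psi> (mat_trace A) * \<psi> (mat_trace D) * \<psi> (mat_trace (C * n))"
    if n: "n \<in> carrier_mat c d" for n
  proof -
    have "det (?g * shear c d n) = det ?g"
      using c n by (simp add: det_mult[of _ "c + d"] det_shear)
    moreover have "mat_trace (?g * shear c d n) = mat_trace A + (mat_trace D + mat_trace (C * n))"
      using c n by (simp add: four_block_mult_shear mat_trace_four_block[of _ c _ d] mat_trace_add[of _ d] add_ac)
    ultimately show ?thesis by (simp add: twist_def additive_character_add[OF add])
  qed
  then have "(\<Sum>n\<in>carrier_mat c d. twist \<chi> \<psi> (?g * shear c d n)) =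
      \<chi> (det ?g) * \<psi> (mat_trace A) * \<psi> (mat_trace D) * (\<Sum>n\<in>carrier_mat c d. \<psi> (mat_trace (C * n)))"
    by (simp add: sum_distrib_left)
  also have "\<dots> = (if C = 0\<^sub>m d c then of_nat CARD('a) ^ (c * d) * twist \<chi> \<psi> A * twist \<chi> \<psi> D else 0)"
  proof (cases "C = 0\<^sub>m d c")
    case True
    then have "det ?g = det A * det D" "A \<in> GL c" "D \<in> GL d"
      using c g four_block_upper_GL_iff[of A c B d D]
      by (auto simp: det_four_block_mat_lower_left_zero[of _ c _ d])
    then have "\<chi> (det ?g) = \<chi> (det A) * \<chi> (det D)"
      using \<chi> by (simp add: multiplicative_character_def GL_det[of A c] GL_det[of D d])
    then show ?thesis
      using sum_additive_character_trace[OF \<psi> c(3)] True by (simp add: twist_def)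
  qed (simp add: sum_additive_character_trace[OF \<psi> c(3)])
  finally show ?thesis .
qed

section \<open>Sylvester equations\<close>

text \<open>
  Horner's scheme for \<open>x p(A)\<close>, where \<open>p(A)\<close> is the value of the polynomial \<open>p\<close> at the square
  matrix \<open>A\<close>. The matrix \<open>x\<close> may be rectangular.
\<close>

definition poly_act :: "'b :: comm_ring_1 mat \<Rightarrow> 'b mat \<Rightarrow> 'b poly \<Rightarrow> 'b mat" where
  "poly_act A x p = foldr (\<lambda>a M. a \<cdot>\<^sub>m x + M * A) (coeffs p) (0\<^sub>m (dim_row x) (dim_col x))"

context
  fixes A x :: "'b :: comm_ring_1 mat" and r c :: nat
  assumes A: "A \<in> carrier_mat c c" and x: "x \<in> carrier_mat r c"
begin

lemma poly_act_0: "poly_act A x 0 = 0\<^sub>m r c"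
  using x by (simp add: poly_act_def)

lemma poly_act_pCons: "poly_act A x (pCons a p) = a \<cdot>\<^sub>m x + poly_act A x p * A"
proof (cases "a = 0 \<and> p = 0")
  case True
  then show ?thesis using A x by (auto simp: poly_act_0 intro!: eq_matI)
next
  case False
  then show ?thesis by (auto simp: poly_act_def cCons_def)
qed

lemma poly_act_carrier: "poly_act A x p \<in> carrier_mat r c"
  by (induction p) (use A x in \<open>auto simp: poly_act_0 poly_act_pCons\<close>)

lemma poly_act_add: "poly_act A x (p + q) = poly_act A x p + poly_act A x q"
proof (induction p q rule: poly_induct2)
  case 0
  show ?case by (auto simp: poly_act_0)
next
  case (pCons a p b q)
  let ?P = "poly_act A x p" and ?Q = "poly_act A x q"
  have c: "?P * A \<in> carrier_mat r c" "?Q * A \<in> carrier_mat r c"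
    by (rule mult_carrier_mat[OF poly_act_carrier A])+
  have gen: "(a + b) \<cdot>\<^sub>m x + (P + Q) = (a \<cdot>\<^sub>m x + P) + (b \<cdot>\<^sub>m x + Q)"
    if "P \<in> carrier_mat r c" "Q \<in> carrier_mat r c" for P Q
    using that x by (intro eq_matI) (auto simp: algebra_simps)
  have "poly_act A x (pCons a p + pCons b q) = (a + b) \<cdot>\<^sub>m x + (?P + ?Q) * A"
    by (simp add: poly_act_pCons pCons.IH)
  also have "(?P + ?Q) * A = ?P * A + ?Q * A"
    by (rule add_mult_distrib_mat[OF poly_act_carrier poly_act_carrier A])
  also have "(a + b) \<cdot>\<^sub>m x + (?P * A + ?Q * A) = (a \<cdot>\<^sub>m x + ?P * A) + (b \<cdot>\<^sub>m x + ?Q * A)"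
    by (rule gen[OF c])
  finally show ?case by (simp add: poly_act_pCons)
qed

lemma poly_act_smult: "poly_act A x (Polynomial.smult t p) = t \<cdot>\<^sub>m poly_act A x p"
proof (induction p)
  case 0
  show ?case by (auto simp: poly_act_0 intro!: eq_matI)
next
  case (pCons a p)
  let ?P = "poly_act A x p"
  have c: "?P * A \<in> carrier_mat r c" by (rule mult_carrier_mat[OF poly_act_carrier A])
  have gen: "(t * a) \<cdot>\<^sub>m x + t \<cdot>\<^sub>m P = t \<cdot>\<^sub>m (a \<cdot>\<^sub>m x + P)"
    if "P \<in> carrier_mat r c" for P
    using that x by (intro eq_matI) (auto simp: algebra_simps)
  have "poly_act A x (Polynomial.smult t (pCons a p)) = (t * a) \<cdot>\<^sub>m x + (t \<cdot>\<^sub>m ?P) * A"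
    by (simp add: poly_act_pCons pCons.IH)
  also have "(t \<cdot>\<^sub>m ?P) * A = t \<cdot>\<^sub>m (?P * A)"
    by (rule mult_smult_assoc_mat[OF poly_act_carrier A])
  also have "(t * a) \<cdot>\<^sub>m x + t \<cdot>\<^sub>m (?P * A) = t \<cdot>\<^sub>m (a \<cdot>\<^sub>m x + ?P * A)"
    by (rule gen[OF c])
  finally show ?case by (simp add: poly_act_pCons)
qed

lemma poly_act_linear_factor:
  "poly_act A x ([:- e, 1:] * q) = poly_act A x q * A - e \<cdot>\<^sub>m poly_act A x q"
proof -
  have "[:- e, 1:] * q = pCons 0 q + Polynomial.smult (- e) q" by simp
  then have "poly_act A x ([:- e, 1:] * q) = (0 \<cdot>\<^sub>m x + poly_act A x q * A) + (- e) \<cdot>\<^sub>m poly_act A x q"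
    by (simp only: poly_act_add poly_act_smult poly_act_pCons)
  also have "\<dots> = poly_act A x q * A - e \<cdot>\<^sub>m poly_act A x q"
    using A x poly_act_carrier[of q] by (intro eq_matI) auto
  finally show ?thesis .
qed

lemma poly_act_monom: "poly_act A x (Polynomial.monom a n) = a \<cdot>\<^sub>m (x * A ^\<^sub>m n)"
proof (induction n)
  case 0
  have "Polynomial.monom a 0 = pCons a 0" by (simp add: monom_0)
  then show ?case using A x by (auto simp: poly_act_pCons poly_act_0 intro!: eq_matI)
next
  case (Suc n)
  have car: "x * A ^\<^sub>m n \<in> carrier_mat r c" using x pow_carrier_mat[OF A] by simp
  have "x * A ^\<^sub>m n * A = x * A ^\<^sub>m Suc n"
    using assoc_mult_mat[OF x pow_carrier_mat[OF A] A] by (simp only: pow_mat.simps)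
  then have *: "a \<cdot>\<^sub>m (x * A ^\<^sub>m n) * A = a \<cdot>\<^sub>m (x * A ^\<^sub>m Suc n)"
    using mult_smult_assoc_mat[OF car A] by (simp only:)
  have car': "a \<cdot>\<^sub>m (x * A ^\<^sub>m n) * A \<in> carrier_mat r c"
    using car A by (intro mult_carrier_mat[of _ r c]) auto
  have "poly_act A x (Polynomial.monom a (Suc n)) = 0 \<cdot>\<^sub>m x + a \<cdot>\<^sub>m (x * A ^\<^sub>m n) * A"
    by (simp add: monom_Suc poly_act_pCons Suc)
  also have "\<dots> = a \<cdot>\<^sub>m (x * A ^\<^sub>m n) * A" using x car' by (intro eq_matI) auto
  finally show ?case by (simp only: *)
qed

lemma poly_act_intertwines:
  assumes H: "H \<in> carrier_mat r r" and Hx: "H * x = x * A"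
  shows "H * poly_act A x p = poly_act A x p * A"
proof (induction p)
  case 0
  show ?case using A H by (simp add: poly_act_0)
next
  case (pCons a p)
  let ?P = "poly_act A x p"
  have c: "?P * A \<in> carrier_mat r c" by (rule mult_carrier_mat[OF poly_act_carrier A])
  have "H * (a \<cdot>\<^sub>m x + ?P * A) = H * (a \<cdot>\<^sub>m x) + H * (?P * A)"
    using H c x by (intro mult_add_distrib_mat) auto
  also have "H * (a \<cdot>\<^sub>m x) = a \<cdot>\<^sub>m x * A"
    using mult_smult_distrib[OF H x] mult_smult_assoc_mat[OF x A] by (simp add: Hx)
  also have "H * (?P * A) = ?P * A * A"
    using assoc_mult_mat[OF H poly_act_carrier A, of p] by (simp add: pCons.IH)
  also have "a \<cdot>\<^sub>m x * A + ?P * A * A = (a \<cdot>\<^sub>m x + ?P * A) * A"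
    using c x A by (intro add_mult_distrib_mat[symmetric]) auto
  finally show ?case by (simp add: poly_act_pCons)
qed

end

text \<open>
  Split \<open>p\<close> into linear factors and apply the factors \<open>A - e\<close> to \<open>x\<close> one at a time, from the
  right. All intermediate matrices intertwine \<open>H\<close> and \<open>A\<close>. The first is \<open>x\<close>, which is nonzero,
  and the last is a scalar multiple of \<open>x p(A) = 0\<close>, so at some stage a nonzero intertwiner \<open>y\<close> satisfies \<open>y (A - e) = 0\<close>.
\<close>

lemma intertwiner_simultaneous_eigen:
  fixes x :: "'b :: alg_closed_field mat"
  assumes A: "A \<in> carrier_mat c c" and H: "H \<in> carrier_mat r r" and x: "x \<in> carrier_mat r c"
    and nz: "x \<noteq> 0\<^sub>m r c" and Hx: "H * x = x * A"
    and "p \<noteq> 0" "poly_act A x p = 0\<^sub>m r c"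
  shows "\<exists>e y. y \<in> carrier_mat r c \<and> y \<noteq> 0\<^sub>m r c \<and> H * y = e \<cdot>\<^sub>m y \<and> y * A = e \<cdot>\<^sub>m y"
  using \<open>p \<noteq> 0\<close> \<open>poly_act A x p = 0\<^sub>m r c\<close>
proof (induction "Polynomial.degree p" arbitrary: p)
  case 0
  then obtain a where p: "p = [:a:]" by (metis degree_eq_zeroE)
  then have "a \<noteq> 0" using 0 by simp
  have "a \<cdot>\<^sub>m x = 0\<^sub>m r c"
    using 0 A x by (simp add: p poly_act_pCons[OF A x] poly_act_0[OF A x])
  then have "inverse a \<cdot>\<^sub>m (a \<cdot>\<^sub>m x) = inverse a \<cdot>\<^sub>m 0\<^sub>m r c" by simp
  moreover have "inverse a \<cdot>\<^sub>m (a \<cdot>\<^sub>m x) = x" "inverse a \<cdot>\<^sub>m 0\<^sub>m r c = 0\<^sub>m r c"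
    using x \<open>a \<noteq> 0\<close> by (auto intro!: eq_matI)
  ultimately show ?case using nz by simp
next
  case (Suc n p)
  then have "Polynomial.degree p > 0" by simp
  then obtain e where "poly p e = 0" using alg_closed_imp_poly_has_root by blast
  then obtain q where p: "p = [:- e, 1:] * q" by (auto simp: poly_eq_0_iff_dvd dvd_def)
  have q: "q \<noteq> 0" using p Suc.prems by auto
  have deg: "n = Polynomial.degree q"
    using Suc.hyps(2) q unfolding p by (subst (asm) degree_mult_eq) auto
  let ?y = "poly_act A x q"
  have y: "?y \<in> carrier_mat r c" by (rule poly_act_carrier[OF A x])
  show ?case
  proof (cases "?y = 0\<^sub>m r c")
    case True
    then show ?thesis using Suc.hyps(1)[OF deg q] by simp
  next
    case False
    have "?y * A - e \<cdot>\<^sub>m ?y = 0\<^sub>m r c"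
      using Suc.prems(2) by (simp only: p poly_act_linear_factor[OF A x])
    moreover have "(?y * A - e \<cdot>\<^sub>m ?y) + e \<cdot>\<^sub>m ?y = ?y * A"
      using y A by (intro eq_matI) auto
    ultimately have "?y * A = e \<cdot>\<^sub>m ?y" using y by simp
    moreover have "H * ?y = ?y * A" by (rule poly_act_intertwines[OF A x H Hx])
    ultimately show ?thesis using y False by auto
  qed
qed

text \<open>
  Every nonzero column of \<open>y\<close> is an eigenvector of \<open>H\<close>.
\<close>

lemma eigenvalueI_mat:
  assumes H: "H \<in> carrier_mat r r" and y: "y \<in> carrier_mat r c" "y \<noteq> 0\<^sub>m r c"
    and eq: "H * y = e \<cdot>\<^sub>m y"
  shows "eigenvalue H e"
proof -
  obtain i j where ij: "i < r" "j < c" "y $$ (i, j) \<noteq> 0"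
    using y by (metis (no_types, lifting) carrier_matD eq_matI index_zero_mat)
  have "H *\<^sub>v col y j = col (H * y) j"
    using H y ij by (intro eq_vecI) auto
  also have "\<dots> = e \<cdot>\<^sub>v col y j" unfolding eq using y ij by (intro eq_vecI) auto
  finally have "H *\<^sub>v col y j = e \<cdot>\<^sub>v col y j" .
  moreover have "col y j \<noteq> 0\<^sub>v r"
  proof
    assume "col y j = 0\<^sub>v r"
    then have "col y j $ i = 0" using ij by simp
    then show False using ij y by simp
  qed
  ultimately show ?thesis
    using H y ij by (auto simp: eigenvalue_def eigenvector_def intro!: exI[of _ "col y j"])
qed

lemma eigenvalue_transpose:
  assumes "A \<in> carrier_mat n n"
  shows "eigenvalue (transpose_mat A) e \<longleftrightarrow> eigenvalue (A :: 'b :: field mat) e"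
  using assms eigenvalue_root_char_poly[of A n e] eigenvalue_root_char_poly[of "transpose_mat A" n e]
  by simp

text \<open>
  A nonzero intertwiner yields a nonzero \<open>y\<close> with \<open>h\<^sub>1 y = e y = y h\<^sub>2\<close> over the algebraic closure;
  its nonzero columns are eigenvectors of \<open>h\<^sub>1\<close> and its nonzero rows left eigenvectors of \<open>h\<^sub>2\<close>, both for the
  eigenvalue \<open>e\<close>. A polynomial with \<open>x p(h\<^sub>2) = 0\<close> is needed to start; over a finite field there is
  a very simple one, since the matrices \<open>x h\<^sub>2\<^sup>n\<close> cannot all be distinct.
\<close>

lemma intertwiner_zero:
  fixes h\<^sub>1 h\<^sub>2 x :: "'a :: {finite, field} mat"
  assumes h1: "h\<^sub>1 \<in> carrier_mat c c" and h2: "h\<^sub>2 \<in> carrier_mat d d" and x: "x \<in> carrier_mat c d"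
    and no_common: "\<not> (\<exists>z :: 'a alg_closure. eigenvalue (map_mat to_ac h\<^sub>1) z \<and> eigenvalue (map_mat to_ac h\<^sub>2) z)"
    and eq: "h\<^sub>1 * x = x * h\<^sub>2"
  shows "x = 0\<^sub>m c d"
proof (rule ccontr)
  assume nz: "x \<noteq> 0\<^sub>m c d"
  interpret to_ac: semiring_hom "to_ac :: 'a \<Rightarrow> 'a alg_closure" by unfold_locales auto
  let ?H = "map_mat to_ac h\<^sub>1" and ?A = "map_mat to_ac h\<^sub>2" and ?x = "map_mat to_ac x"
  have c: "?H \<in> carrier_mat c c" "?A \<in> carrier_mat d d" "?x \<in> carrier_mat c d"
    using h1 h2 x by auto
  have "?x \<noteq> 0\<^sub>m c d"
  proof
    assume "?x = 0\<^sub>m c d"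
    then have "to_ac (x $$ (i, j)) = 0" if "i < c" "j < d" for i j
      using that x by (metis carrier_matD index_map_mat(1) index_zero_mat(1))
    then show False using nz x by (auto intro!: eq_matI)
  qed
  moreover have "?H * ?x = ?x * ?A"
    using to_ac.mat_hom_mult[OF h1 x] to_ac.mat_hom_mult[OF x h2] eq by simp
  moreover obtain p :: "'a alg_closure poly" where "p \<noteq> 0" "poly_act ?A ?x p = 0\<^sub>m c d"
  proof -
    have "\<not> inj (\<lambda>n. x * h\<^sub>2 ^\<^sub>m n)"
    proof
      assume "inj (\<lambda>n. x * h\<^sub>2 ^\<^sub>m n)"
      then have "infinite (range (\<lambda>n. x * h\<^sub>2 ^\<^sub>m n))" using finite_imageD by blast
      moreover have "range (\<lambda>n. x * h\<^sub>2 ^\<^sub>m n) \<subseteq> carrier_mat c d"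
        using x pow_carrier_mat[OF h2] by auto
      ultimately show False using finite_subset[OF _ finite_carrier_mat] by blast
    qed
    then obtain m n where mn: "m \<noteq> n" "x * h\<^sub>2 ^\<^sub>m m = x * h\<^sub>2 ^\<^sub>m n" by (auto simp: inj_def)
    have hom: "?x * ?A ^\<^sub>m k = map_mat to_ac (x * h\<^sub>2 ^\<^sub>m k)" for k
      using to_ac.mat_hom_mult[OF x pow_carrier_mat[OF h2]] to_ac.mat_hom_pow[OF h2] by simp
    have car: "?x * ?A ^\<^sub>m k \<in> carrier_mat c d" for k
      using c pow_carrier_mat[OF c(2)] by auto
    \<comment> \<open>The polynomial \<open>T\<^sup>m - T\<^sup>n\<close>; it is nonzero since \<open>m \<noteq> n\<close>.\<close>
    let ?p = "Polynomial.monom 1 m + Polynomial.monom (- 1) n :: 'a alg_closure poly"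
    have "Polynomial.coeff ?p m = 1" using mn by simp
    then have nonzero: "?p \<noteq> 0" by (metis coeff_0 zero_neq_one)
    have "poly_act ?A ?x ?p = 1 \<cdot>\<^sub>m (?x * ?A ^\<^sub>m m) + (- 1) \<cdot>\<^sub>m (?x * ?A ^\<^sub>m n)"
      by (simp only: poly_act_add[OF c(2,3)] poly_act_monom[OF c(2,3)])
    then have "poly_act ?A ?x ?p = 1 \<cdot>\<^sub>m (?x * ?A ^\<^sub>m n) + (- 1) \<cdot>\<^sub>m (?x * ?A ^\<^sub>m n)"
      unfolding hom mn(2) .
    moreover have "1 \<cdot>\<^sub>m M + (- 1) \<cdot>\<^sub>m M = 0\<^sub>m c d" if "M \<in> carrier_mat c d" for M :: "'a alg_closure mat"
      using that by (intro eq_matI) auto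
    then have "1 \<cdot>\<^sub>m (?x * ?A ^\<^sub>m n) + (- 1) \<cdot>\<^sub>m (?x * ?A ^\<^sub>m n) = 0\<^sub>m c d"
      using car by blast
    ultimately have "poly_act ?A ?x ?p = 0\<^sub>m c d" by (simp only:)
    with nonzero show thesis by (rule that)
  qed
  ultimately obtain e y where y: "y \<in> carrier_mat c d" "y \<noteq> 0\<^sub>m c d" "?H * y = e \<cdot>\<^sub>m y" "y * ?A = e \<cdot>\<^sub>m y"
    using intertwiner_simultaneous_eigen[OF c(2,1,3)] by blast
  have "eigenvalue ?H e" by (rule eigenvalueI_mat[OF c(1) y(1-3)])
  moreover have "eigenvalue (transpose_mat ?A) e"
  proof (rule eigenvalueI_mat)
    show "transpose_mat ?A \<in> carrier_mat d d" "transpose_mat y \<in> carrier_mat d c" using c y by auto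
    show "transpose_mat y \<noteq> 0\<^sub>m d c" using y(2) by (metis transpose_transpose zero_transpose_mat)
    have "transpose_mat ?A * transpose_mat y = transpose_mat (y * ?A)"
      by (rule transpose_mult[OF y(1) c(2), symmetric])
    also have "\<dots> = e \<cdot>\<^sub>m transpose_mat y" unfolding y(4) by (auto intro!: eq_matI)
    finally show "transpose_mat ?A * transpose_mat y = e \<cdot>\<^sub>m transpose_mat y" .
  qed
  then have "eigenvalue ?A e" using eigenvalue_transpose[OF c(2)] by simp
  ultimately show False using no_common by blast
qed

text \<open>
  The Sylvester operator \<open>x \<mapsto> x h\<^sub>2 - h\<^sub>1 x\<close> is additive and its kernel consists of intertwiners, so
  it is injective; on a finite set it is therefore surjective.
\<close>

lemma sylvester_solvable:
  fixes h\<^sub>1 h\<^sub>2 m :: "'a :: {finite, field} mat"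
  assumes h1: "h\<^sub>1 \<in> carrier_mat c c" and h2: "h\<^sub>2 \<in> carrier_mat d d" and m: "m \<in> carrier_mat c d"
    and no_common: "\<not> (\<exists>z :: 'a alg_closure. eigenvalue (map_mat to_ac h\<^sub>1) z \<and> eigenvalue (map_mat to_ac h\<^sub>2) z)"
  obtains x where "x \<in> carrier_mat c d" "x * h\<^sub>2 - h\<^sub>1 * x = m"
proof -
  let ?L = "\<lambda>x. x * h\<^sub>2 - h\<^sub>1 * x"
  have "inj_on ?L (carrier_mat c d)"
  proof (rule inj_onI)
    fix x y :: "'a mat"
    assume x: "x \<in> carrier_mat c d" and y: "y \<in> carrier_mat c d" and eq: "?L x = ?L y"
    note car = mult_carrier_mat[OF x h2] mult_carrier_mat[OF y h2] mult_carrier_mat[OF h1 x] mult_carrier_mat[OF h1 y]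
    have exchange: "U - V = W - Y"
      if "U \<in> carrier_mat c d" "V \<in> carrier_mat c d" "W \<in> carrier_mat c d" "Y \<in> carrier_mat c d"
        "U - W = V - Y" for U V W Y :: "'a mat"
    proof (rule eq_matI)
      fix i j assume "i < dim_row (W - Y)" "j < dim_col (W - Y)"
      then show "(U - V) $$ (i, j) = (W - Y) $$ (i, j)"
        using that(1-4) arg_cong[OF that(5), of "\<lambda>M. M $$ (i, j)"] by (simp add: algebra_simps)
    qed (use that in auto)
    have "h\<^sub>1 * (x - y) = h\<^sub>1 * x - h\<^sub>1 * y" using h1 x y by (rule mult_minus_distrib_mat)
    also have "\<dots> = x * h\<^sub>2 - y * h\<^sub>2"
      by (rule exchange[OF car eq, symmetric])
    also have "\<dots> = (x - y) * h\<^sub>2" using x y h2 by (rule minus_mult_distrib_mat[symmetric])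
    finally have "x - y = 0\<^sub>m c d"
      using x y by (intro intertwiner_zero[OF h1 h2 _ no_common]) auto
    then have "x - y + y = y" using y by simp
    moreover have "x - y + y = x" using x y by (auto intro!: eq_matI)
    ultimately show "x = y" by simp
  qed
  moreover have "?L ` carrier_mat c d \<subseteq> carrier_mat c d" using h1 h2 by auto
  ultimately have "?L ` carrier_mat c d = carrier_mat c d"
    by (intro endo_inj_surj finite_carrier_mat)
  then have "m \<in> ?L ` carrier_mat c d" using m by blast
  then show thesis using that by auto
qed

section \<open>Kloosterman sums over cosets of the unipotent radical\<close>

lemma gl_inv_upper:
  fixes a b m :: "'a :: field mat"
  assumes a: "a \<in> GL c" and d: "b \<in> GL d" and m: "m \<in> carrier_mat c d"
  shows "gl_inv (four_block_mat a (a * m) (0\<^sub>m d c) b) =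
    four_block_mat (gl_inv a) (- (m * gl_inv b)) (0\<^sub>m d c) (gl_inv b)"
proof (rule gl_inv_unique[where c = "c + d"])
  note car = GL_carrier[OF a] GL_carrier[OF d] gl_inv_carrier[OF a] gl_inv_carrier[OF d] m
  have mb: "m * gl_inv b \<in> carrier_mat c d" and am: "a * m \<in> carrier_mat c d" using car by auto
  have amb: "a * (m * gl_inv b) \<in> carrier_mat c d" using car(1) mb by simp
  show "four_block_mat a (a * m) (0\<^sub>m d c) b \<in> carrier_mat (c + d) (c + d)"
    "four_block_mat (gl_inv a) (- (m * gl_inv b)) (0\<^sub>m d c) (gl_inv b) \<in> carrier_mat (c + d) (c + d)"
    using car by auto
  have "- (a * (m * gl_inv b)) + a * m * gl_inv b = - (a * (m * gl_inv b)) + a * (m * gl_inv b)"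
    using assoc_mult_mat[OF car(1) m car(4)] by (simp only:)
  also have "\<dots> = 0\<^sub>m c d" using amb by (intro eq_matI) auto
  finally have *: "- (a * (m * gl_inv b)) + a * m * gl_inv b = 0\<^sub>m c d" .
  have **: "- 0\<^sub>m d d + 1\<^sub>m d = (1\<^sub>m d :: 'a mat)" by (intro eq_matI) auto
  show "four_block_mat a (a * m) (0\<^sub>m d c) b *
      four_block_mat (gl_inv a) (- (m * gl_inv b)) (0\<^sub>m d c) (gl_inv b) = 1\<^sub>m (c + d)"
    using car mb am
    by (subst mult_four_block_mat[of _ c c _ d _ d _ _ c _ d])
       (simp_all add: * ** gl_inv_right[OF a] gl_inv_right[OF d] del: assoc_mult_mat)
qed

lemma four_block_split:
  assumes "M \<in> carrier_mat (c + d) (c + d)"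
  obtains A B C D where "A \<in> carrier_mat c c" "B \<in> carrier_mat c d" "C \<in> carrier_mat d c" "D \<in> carrier_mat d d"
    "M = four_block_mat A B C D"
proof -
  obtain A B C D where s: "split_block M c c = (A, B, C, D)" by (metis prod_cases4)
  from split_block[OF s, of d d] assms show thesis by (intro that) auto
qed

text \<open>
  Substituting \<open>z = u(n)\<^sup>-\<^sup>1 w\<close> in the recursion moves \<open>u(n)\<close> from the first factor of the
  convolution to the remaining ones, where an inductive hypothesis about sums over \<open>n\<close> applies.
\<close>

lemma sum_Kl_shear_Suc:
  fixes g :: "'a :: {finite, field} mat"
  assumes \<psi>: "additive_character \<psi>" and g: "g \<in> GL (c + d)"
  shows "(\<Sum>n\<in>carrier_mat c d. Kl (Suc k) \<alpha> \<psi> (g * shear c d n)) =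
    (\<Sum>w\<in>GL (c + d). twist (\<alpha> 0) \<psi> (g * w) *
      (\<Sum>n\<in>carrier_mat c d. Kl k (\<lambda>j. \<alpha> (Suc j)) \<psi> (gl_inv w * shear c d n)))"
proof -
  have "Kl (Suc k) \<alpha> \<psi> (g * shear c d n) = (\<Sum>w\<in>GL (c + d). twist (\<alpha> 0) \<psi> (g * w) *
      Kl k (\<lambda>j. \<alpha> (Suc j)) \<psi> (gl_inv w * shear c d n))" if n: "n \<in> carrier_mat c d" for n
  proof -
    let ?u = "shear c d n" and ?v = "shear c d (- n)"
    have u: "?u \<in> GL (c + d)" and v: "?v \<in> GL (c + d)" using n by (auto intro: shear_GL)
    have "gl_inv ?v = shear c d (- (- n))" using n by (intro gl_inv_shear) simp
    moreover have "- (- n) = n" using n by (intro eq_matI) auto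
    ultimately have inv: "gl_inv ?v = ?u" by simp
    have "Kl (Suc k) \<alpha> \<psi> (g * ?u) = (\<Sum>z\<in>GL (c + d). twist (\<alpha> 0) \<psi> (g * ?u * z) *
        Kl k (\<lambda>j. \<alpha> (Suc j)) \<psi> (gl_inv z))"
      by (rule Kl_Suc[OF \<psi> GL_mult[OF g u]])
    also have "\<dots> = (\<Sum>w\<in>GL (c + d). twist (\<alpha> 0) \<psi> (g * ?u * (?v * w)) *
        Kl k (\<lambda>j. \<alpha> (Suc j)) \<psi> (gl_inv (?v * w)))"
      by (rule sum.reindex_bij_betw[OF bij_betw_GL_mult_left[OF v], symmetric])
    also have "\<dots> = (\<Sum>w\<in>GL (c + d). twist (\<alpha> 0) \<psi> (g * w) *
        Kl k (\<lambda>j. \<alpha> (Suc j)) \<psi> (gl_inv w * ?u))"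
    proof (rule sum.cong[OF refl])
      fix w :: "'a mat" assume w: "w \<in> GL (c + d)"
      have "g * ?u * (?v * w) = g * (?u * (?v * w))"
        by (rule assoc_mult_mat[OF GL_carrier[OF g] GL_carrier[OF u]
              mult_carrier_mat[OF GL_carrier[OF v] GL_carrier[OF w]]])
      also have "?u * (?v * w) = w"
        using GL_cancel_left(1)[OF v GL_carrier[OF w]] by (simp only: inv)
      finally have 1: "g * ?u * (?v * w) = g * w" .
      have 2: "gl_inv (?v * w) = gl_inv w * ?u" using gl_inv_mult[OF v w] by (simp only: inv)
      show "twist (\<alpha> 0) \<psi> (g * ?u * (?v * w)) * Kl k (\<lambda>j. \<alpha> (Suc j)) \<psi> (gl_inv (?v * w)) =
          twist (\<alpha> 0) \<psi> (g * w) * Kl k (\<lambda>j. \<alpha> (Suc j)) \<psi> (gl_inv w * ?u)"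
        by (simp only: 1 2)
    qed
    finally show ?thesis .
  qed
  then show ?thesis by (subst sum_distrib_left) (subst sum.swap, simp)
qed

text \<open>
  A parametrisation of the block upper triangular group by its Levi decomposition: the value is
  \<open>diag(a, b) u(m)\<close>, with the unipotent factor on the right so that summing over \<open>m\<close> is summing over a
  coset of \<open>U\<close>.
\<close>

definition parabolic_mat :: "nat \<Rightarrow> nat \<Rightarrow> ('a :: field mat \<times> 'a mat) \<times> 'a mat \<Rightarrow> 'a mat" where
  "parabolic_mat c d = (\<lambda>((a, b), m). four_block_mat a (a * m) (0\<^sub>m d c) b)"

lemma parabolic_mat_in_GL:
  "p \<in> (GL c \<times> GL d) \<times> carrier_mat c d \<Longrightarrow> parabolic_mat c d p \<in> GL (c + d)"
  unfolding parabolic_mat_def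
  by (auto simp: four_block_upper_GL_iff[OF GL_carrier mult_carrier_mat[OF GL_carrier] GL_carrier])

lemma inj_on_parabolic_mat:
  "inj_on (parabolic_mat c d) ((GL c \<times> GL d) \<times> carrier_mat c d)"
proof (rule inj_onI)
  fix p p' :: "('a mat \<times> 'a mat) \<times> 'a mat"
  assume "p \<in> (GL c \<times> GL d) \<times> carrier_mat c d" "p' \<in> (GL c \<times> GL d) \<times> carrier_mat c d"
    and "parabolic_mat c d p = parabolic_mat c d p'"
  moreover obtain a b m a' b' m' where p: "p = ((a, b), m)" "p' = ((a', b'), m')"
    by (metis prod.exhaust)
  ultimately have GL: "a \<in> GL c" "b \<in> GL d" "m \<in> carrier_mat c d" "a' \<in> GL c" "b' \<in> GL d" "m' \<in> carrier_mat c d"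
    and eq: "parabolic_mat c d ((a, b), m) = parabolic_mat c d ((a', b'), m')"
    by auto
  note car = GL_carrier[OF GL(1)] GL_carrier[OF GL(2)] GL_carrier[OF GL(4)] GL_carrier[OF GL(5)]
  have "a = a' \<and> a * m = a' * m' \<and> (0\<^sub>m d c :: 'a mat) = 0\<^sub>m d c \<and> b = b'"
    using eq car GL(3,6) unfolding parabolic_mat_def split
    by (subst (asm) four_block_eq_iff[of _ c c _ d _ d]) auto
  moreover from this have "gl_inv a * (a * m) = gl_inv a * (a * m')" by metis
  then have "m = m'" by (simp only: GL_cancel_left[OF GL(1) GL(3)] GL_cancel_left[OF GL(1) GL(6)])
  ultimately show "p = p'" by (simp add: p)
qed

lemma upper_in_range_parabolic_mat:
  assumes c: "A \<in> carrier_mat c c" "B \<in> carrier_mat c d" "D \<in> carrier_mat d d"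
    and GL: "four_block_mat A B (0\<^sub>m d c) D \<in> GL (c + d)"
  shows "four_block_mat A B (0\<^sub>m d c) D \<in> parabolic_mat c d ` ((GL c \<times> GL d) \<times> carrier_mat c d)"
proof -
  have A: "A \<in> GL c" and D: "D \<in> GL d" using four_block_upper_GL_iff[OF c] GL by auto
  have "A * (gl_inv A * B) = B" by (rule GL_cancel_left[OF A c(2)])
  then have "four_block_mat A B (0\<^sub>m d c) D = parabolic_mat c d ((A, D), gl_inv A * B)"
    by (simp only: parabolic_mat_def split)
  moreover have "gl_inv A * B \<in> carrier_mat c d" using gl_inv_carrier[OF A] c(2) by simp
  ultimately show ?thesis using A D by blast
qed

text \<open>
  The block upper triangular matrices are closed under inversion, so the inverse of a matrix outside
  that group is outside as well.
\<close>

lemma lower_left_inverse_nonzero: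
  assumes w: "w \<in> GL (c + d)" "w \<notin> parabolic_mat c d ` ((GL c \<times> GL d) \<times> carrier_mat c d)"
    and c: "A \<in> carrier_mat c c" "B \<in> carrier_mat c d" "C \<in> carrier_mat d c" "D \<in> carrier_mat d d"
    and inv: "gl_inv w = four_block_mat A B C D"
  shows "C \<noteq> 0\<^sub>m d c"
proof
  assume C: "C = 0\<^sub>m d c"
  have "gl_inv w \<in> GL (c + d)" using w(1) by (rule gl_inv_GL)
  then have "gl_inv w \<in> parabolic_mat c d ` ((GL c \<times> GL d) \<times> carrier_mat c d)"
    unfolding inv C by (rule upper_in_range_parabolic_mat[OF c(1,2,4)])
  then obtain a b m where p: "a \<in> GL c" "b \<in> GL d" "m \<in> carrier_mat c d"
    and eq: "gl_inv w = four_block_mat a (a * m) (0\<^sub>m d c) b"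
    by (auto simp: parabolic_mat_def)
  have "w = gl_inv (gl_inv w)" using gl_inv_gl_inv[OF w(1)] by simp
  also have "\<dots> = four_block_mat (gl_inv a) (- (m * gl_inv b)) (0\<^sub>m d c) (gl_inv b)"
    unfolding eq by (rule gl_inv_upper[OF p])
  finally have w': "w = \<dots>" .
  have "w \<in> parabolic_mat c d ` ((GL c \<times> GL d) \<times> carrier_mat c d)"
    unfolding w'
    by (rule upper_in_range_parabolic_mat)
       (use p w w' gl_inv_carrier[OF p(1)] gl_inv_carrier[OF p(2)] in auto)
  with w(2) show False by blast
qed

lemma GL_mult_right_eq_0_iff:
  assumes "a \<in> GL c" "C \<in> carrier_mat d c"
  shows "C * a = 0\<^sub>m d c \<longleftrightarrow> C = 0\<^sub>m d c"
proof
  assume "C * a = 0\<^sub>m d c"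
  then have "C * a * gl_inv a = 0\<^sub>m d c" using gl_inv_carrier[OF assms(1)] by simp
  then show "C = 0\<^sub>m d c" using GL_cancel_right(1)[OF assms] by simp
qed (use GL_carrier[OF assms(1)] in simp)

text \<open>
  The inductive step uses coset sums twice. After \<open>sum_Kl_shear_Suc\<close> the inductive hypothesis
  evaluates the inner sum, which vanishes unless \<open>w\<close> is block upper triangular and depends only on the
  diagonal blocks \<open>a, b\<close> of \<open>w\<close>. For fixed \<open>a, b\<close> what remains is a sum of \<open>twist\<close> over
  a coset of \<open>U\<close>, given by \<open>sum_twist_shear\<close>. The resulting double sum over \<open>a\<close> and \<open>b\<close> splits into the
  recursions for the two diagonal blocks.
\<close>

lemma sum_Kl_shear:
  fixes \<psi> :: "'a :: {finite, field} \<Rightarrow> complex"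
  assumes \<psi>: "nontrivial_additive_character \<psi>"
    and "\<And>j. j < k \<Longrightarrow> multiplicative_character (\<alpha> j)"
    and "A \<in> carrier_mat c c" "B \<in> carrier_mat c d" "C \<in> carrier_mat d c" "D \<in> carrier_mat d d"
    and "four_block_mat A B C D \<in> GL (c + d)"
  shows "(\<Sum>n\<in>carrier_mat c d. Kl k \<alpha> \<psi> (four_block_mat A B C D * shear c d n)) =
    (if C = 0\<^sub>m d c then of_nat CARD('a) ^ (k * (c * d)) * Kl k \<alpha> \<psi> A * Kl k \<alpha> \<psi> D else 0)"
  using assms(2-)
proof (induction k arbitrary: \<alpha> A B C D)
  case (0 \<alpha> A B C D)
  have add: "additive_character \<psi>" using \<psi> by (simp add: nontrivial_additive_character_def)
  note c = "0.prems"(2-5)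
  have "Kl 0 \<alpha> \<psi> (four_block_mat A B C D * shear c d n) =
      (if n = - B then if A = 1\<^sub>m c \<and> C = 0\<^sub>m d c \<and> D = 1\<^sub>m d then 1 else 0 else 0)"
    if n: "n \<in> carrier_mat c d" for n
  proof -
    have "four_block_mat A B C D * shear c d n = 1\<^sub>m (c + d) \<longleftrightarrow>
        four_block_mat A (A * n + B) C (C * n + D) = four_block_mat (1\<^sub>m c) (0\<^sub>m c d) (0\<^sub>m d c) (1\<^sub>m d)"
      using c n by (simp add: four_block_mult_shear[of _ c c _ d _ d])
    also have "\<dots> \<longleftrightarrow> A = 1\<^sub>m c \<and> A * n + B = 0\<^sub>m c d \<and> C = 0\<^sub>m d c \<and> C * n + D = 1\<^sub>m d"
      using c n by (intro four_block_eq_iff) auto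
    also have "\<dots> \<longleftrightarrow> A = 1\<^sub>m c \<and> n + B = 0\<^sub>m c d \<and> C = 0\<^sub>m d c \<and> D = 1\<^sub>m d"
      using c n by auto
    also have "n + B = 0\<^sub>m c d \<longleftrightarrow> n = - B"
    proof
      assume "n + B = 0\<^sub>m c d"
      then have "n + B + - B = - B" using c by simp
      moreover have "n + B + - B = n" using c n by (auto intro!: eq_matI)
      ultimately show "n = - B" by simp
    qed (use c in \<open>auto intro!: eq_matI\<close>)
    finally have "four_block_mat A B C D * shear c d n = 1\<^sub>m (c + d) \<longleftrightarrow>
        A = 1\<^sub>m c \<and> n = - B \<and> C = 0\<^sub>m d c \<and> D = 1\<^sub>m d" .
    moreover have "four_block_mat A B C D * shear c d n \<in> carrier_mat (c + d) (c + d)"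
      using c n by (intro mult_carrier_mat[of _ _ "c + d"]) auto
    ultimately show ?thesis by (simp add: Kl_0[OF add])
  qed
  then have "(\<Sum>n\<in>carrier_mat c d. Kl 0 \<alpha> \<psi> (four_block_mat A B C D * shear c d n)) =
      (if A = 1\<^sub>m c \<and> C = 0\<^sub>m d c \<and> D = 1\<^sub>m d then 1 else 0)"
    using c by (simp add: sum.delta finite_carrier_mat)
  then show ?case using c by (simp add: Kl_0[OF add])
next
  case (Suc k \<alpha> A B C D)
  have add: "additive_character \<psi>" using \<psi> by (simp add: nontrivial_additive_character_def)
  note c = Suc.prems(2-5) and g = Suc.prems(6)
  let ?g = "four_block_mat A B C D" and ?\<alpha> = "\<lambda>j. \<alpha> (Suc j)"
  let ?q = "of_nat CARD('a) :: complex"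
  define T where "T w = (\<Sum>n\<in>carrier_mat c d. Kl k ?\<alpha> \<psi> (gl_inv w * shear c d n))" for w
  let ?P = "(GL c \<times> GL d) \<times> carrier_mat c d :: (('a mat \<times> 'a mat) \<times> 'a mat) set"
  note IH = Suc.IH[of ?\<alpha>, OF Suc.prems(1), simplified]
  \<comment> \<open>The remaining factors are confined to the block upper triangular group.\<close>
  have T0: "T w = 0" if w: "w \<in> GL (c + d)" "w \<notin> parabolic_mat c d ` ?P" for w
  proof -
    have invw: "gl_inv w \<in> GL (c + d)" using w(1) by (rule gl_inv_GL)
    obtain A' B' C' D' where c': "A' \<in> carrier_mat c c" "B' \<in> carrier_mat c d" "C' \<in> carrier_mat d c"
      "D' \<in> carrier_mat d d" and eq: "gl_inv w = four_block_mat A' B' C' D'"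
      using GL_carrier[OF invw] by (rule four_block_split)
    have "C' \<noteq> 0\<^sub>m d c" by (rule lower_left_inverse_nonzero[OF w c' eq])
    then show ?thesis using IH[OF c'] invw by (simp add: T_def eq)
  qed
  \<comment> \<open>There, the inner sum depends only on the diagonal blocks.\<close>
  have T1: "T (parabolic_mat c d ((a, b), m)) = ?q ^ (k * (c * d)) * Kl k ?\<alpha> \<psi> (gl_inv a) * Kl k ?\<alpha> \<psi> (gl_inv b)"
    if p: "a \<in> GL c" "b \<in> GL d" "m \<in> carrier_mat c d" for a b m
  proof -
    have inv: "gl_inv (parabolic_mat c d ((a, b), m)) =
        four_block_mat (gl_inv a) (- (m * gl_inv b)) (0\<^sub>m d c) (gl_inv b)"
      using gl_inv_upper[OF p] by (simp add: parabolic_mat_def)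
    have "gl_inv (parabolic_mat c d ((a, b), m)) \<in> GL (c + d)"
      using p by (intro gl_inv_GL parabolic_mat_in_GL) auto
    then show ?thesis
      unfolding T_def inv using p gl_inv_carrier[OF p(1)] gl_inv_carrier[OF p(2)]
      by (subst IH) auto
  qed
  \<comment> \<open>The first factor is summed over the coset \<open>g diag(a, b) U\<close>.\<close>
  have inner: "(\<Sum>m\<in>carrier_mat c d. twist (\<alpha> 0) \<psi> (?g * parabolic_mat c d ((a, b), m))) =
      (if C = 0\<^sub>m d c then ?q ^ (c * d) * twist (\<alpha> 0) \<psi> (A * a) * twist (\<alpha> 0) \<psi> (D * b) else 0)"
    if p: "a \<in> GL c" "b \<in> GL d" for a b
  proof -
    note ab = GL_carrier[OF p(1)] GL_carrier[OF p(2)]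
    let ?l = "four_block_mat a (0\<^sub>m c d) (0\<^sub>m d c) b"
    have l: "?l \<in> GL (c + d)" using p ab by (simp add: four_block_upper_GL_iff)
    have gl: "?g * ?l = four_block_mat (A * a) (B * b) (C * a) (D * b)"
      using c ab by (subst mult_four_block_mat[of _ c c _ d _ d _ _ c _ d]) auto
    have "?g * parabolic_mat c d ((a, b), m) = ?g * ?l * shear c d m" if m: "m \<in> carrier_mat c d" for m
    proof -
      have "parabolic_mat c d ((a, b), m) = ?l * shear c d m"
        using ab m by (simp add: parabolic_mat_def four_block_mult_shear[of _ c c _ d _ d])
      moreover have "?g * (?l * shear c d m) = ?g * ?l * shear c d m"
        using GL_carrier[OF g] GL_carrier[OF l] shear_carrier by (rule assoc_mult_mat[symmetric])
      ultimately show ?thesis by simp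
    qed
    then have "(\<Sum>m\<in>carrier_mat c d. twist (\<alpha> 0) \<psi> (?g * parabolic_mat c d ((a, b), m))) =
        (\<Sum>m\<in>carrier_mat c d. twist (\<alpha> 0) \<psi> (?g * ?l * shear c d m))" by (intro sum.cong) auto
    also have "\<dots> = (if C * a = 0\<^sub>m d c then ?q ^ (c * d) * twist (\<alpha> 0) \<psi> (A * a) * twist (\<alpha> 0) \<psi> (D * b) else 0)"
      unfolding gl using c ab GL_mult[OF g l] Suc.prems(1)[of 0]
      by (intro sum_twist_shear[OF \<psi>]) (auto simp: gl)
    finally show ?thesis by (simp only: GL_mult_right_eq_0_iff[OF p(1) c(3)])
  qed
  have "(\<Sum>n\<in>carrier_mat c d. Kl (Suc k) \<alpha> \<psi> (?g * shear c d n)) =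
      (\<Sum>w\<in>GL (c + d). twist (\<alpha> 0) \<psi> (?g * w) * T w)"
    unfolding T_def by (rule sum_Kl_shear_Suc[OF add g])
  also have "\<dots> = (\<Sum>w\<in>parabolic_mat c d ` ?P. twist (\<alpha> 0) \<psi> (?g * w) * T w)"
    by (rule sum.mono_neutral_right[OF finite_GL]) (auto intro: parabolic_mat_in_GL simp del: mem_Sigma_iff simp: T0)
  also have "\<dots> = (\<Sum>p\<in>?P. twist (\<alpha> 0) \<psi> (?g * parabolic_mat c d p) * T (parabolic_mat c d p))"
    by (simp add: sum.reindex[OF inj_on_parabolic_mat])
  also have "\<dots> = (\<Sum>(a, b)\<in>GL c \<times> GL d. \<Sum>m\<in>carrier_mat c d.
      twist (\<alpha> 0) \<psi> (?g * parabolic_mat c d ((a, b), m)) * T (parabolic_mat c d ((a, b), m)))"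
    by (simp add: sum.cartesian_product split_def)
  also have "\<dots> = (\<Sum>(a, b)\<in>GL c \<times> GL d. (\<Sum>m\<in>carrier_mat c d.
      twist (\<alpha> 0) \<psi> (?g * parabolic_mat c d ((a, b), m))) *
      (?q ^ (k * (c * d)) * Kl k ?\<alpha> \<psi> (gl_inv a) * Kl k ?\<alpha> \<psi> (gl_inv b)))"
    by (intro sum.cong refl) (auto simp: T1 sum_distrib_right)
  also have "\<dots> = (\<Sum>(a, b)\<in>GL c \<times> GL d.
      (if C = 0\<^sub>m d c then ?q ^ (c * d) * twist (\<alpha> 0) \<psi> (A * a) * twist (\<alpha> 0) \<psi> (D * b) else 0) *
      (?q ^ (k * (c * d)) * Kl k ?\<alpha> \<psi> (gl_inv a) * Kl k ?\<alpha> \<psi> (gl_inv b)))"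
    by (intro sum.cong refl) (auto simp: inner)
  also have "\<dots> = (if C = 0\<^sub>m d c then ?q ^ (Suc k * (c * d)) * Kl (Suc k) \<alpha> \<psi> A * Kl (Suc k) \<alpha> \<psi> D else 0)"
  proof (cases "C = 0\<^sub>m d c")
    case True
    have AD: "A \<in> GL c" "D \<in> GL d" using g four_block_upper_GL_iff[OF c(1,2,4)] True by auto
    have pw: "?q ^ (Suc k * (c * d)) = ?q ^ (c * d) * ?q ^ (k * (c * d))"
      by (simp add: power_add)
    have "(\<Sum>(a, b)\<in>GL c \<times> GL d.
        (?q ^ (c * d) * twist (\<alpha> 0) \<psi> (A * a) * twist (\<alpha> 0) \<psi> (D * b)) *
        (?q ^ (k * (c * d)) * Kl k ?\<alpha> \<psi> (gl_inv a) * Kl k ?\<alpha> \<psi> (gl_inv b))) =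
      (\<Sum>a\<in>GL c. \<Sum>b\<in>GL d. ?q ^ (Suc k * (c * d)) *
        ((twist (\<alpha> 0) \<psi> (A * a) * Kl k ?\<alpha> \<psi> (gl_inv a)) * (twist (\<alpha> 0) \<psi> (D * b) * Kl k ?\<alpha> \<psi> (gl_inv b))))"
      by (subst sum.cartesian_product[symmetric]) (simp only: pw, simp only: mult_ac)
    also have "\<dots> = ?q ^ (Suc k * (c * d)) * (Kl (Suc k) \<alpha> \<psi> A * Kl (Suc k) \<alpha> \<psi> D)"
      unfolding Kl_Suc[OF add AD(1)] Kl_Suc[OF add AD(2)] sum_product
      by (simp only: sum_distrib_left)
    finally show ?thesis using True by (simp add: mult.assoc)
  qed simp
  finally show ?case .
qed

section \<open>Multiplicativity\<close>

text \<open>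
  Seek the conjugator in \<open>U\<close>: the equation \<open>h u(n) u(x) = u(x) h\<close> compares the upper right
  blocks \<open>h\<^sub>1 (n + x)\<close> and \<open>x h\<^sub>2\<close>, which is a Sylvester equation for \<open>x\<close> with right-hand side \<open>h\<^sub>1 n\<close>.
\<close>

lemma block_diag_shear_conj:
  fixes h\<^sub>1 h\<^sub>2 n :: "'a :: {finite, field} mat"
  assumes h1: "h\<^sub>1 \<in> GL c" and h2: "h\<^sub>2 \<in> GL d" and n: "n \<in> carrier_mat c d"
    and no_common: "\<not> (\<exists>z :: 'a alg_closure. eigenvalue (map_mat to_ac h\<^sub>1) z \<and> eigenvalue (map_mat to_ac h\<^sub>2) z)"
  obtains p where "p \<in> GL (c + d)"
    "four_block_mat h\<^sub>1 (0\<^sub>m c d) (0\<^sub>m d c) h\<^sub>2 * shear c d n =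
     p * four_block_mat h\<^sub>1 (0\<^sub>m c d) (0\<^sub>m d c) h\<^sub>2 * gl_inv p"
proof -
  let ?h = "four_block_mat h\<^sub>1 (0\<^sub>m c d) (0\<^sub>m d c) h\<^sub>2"
  note c = GL_carrier[OF h1] GL_carrier[OF h2]
  obtain x where x: "x \<in> carrier_mat c d" and eq: "x * h\<^sub>2 - h\<^sub>1 * x = h\<^sub>1 * n"
    using c n by (rule_tac sylvester_solvable[OF c _ no_common, of "h\<^sub>1 * n"]) auto
  have car: "x * h\<^sub>2 \<in> carrier_mat c d" "h\<^sub>1 * x \<in> carrier_mat c d" using c x by auto
  have "h\<^sub>1 * (n + x) = h\<^sub>1 * n + h\<^sub>1 * x" using c n x by (intro mult_add_distrib_mat) auto
  also have "h\<^sub>1 * n + h\<^sub>1 * x = x * h\<^sub>2"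
  proof -
    have "U - V + V = U" if "U \<in> carrier_mat c d" "V \<in> carrier_mat c d" for U V :: "'a mat"
      using that by (intro eq_matI) auto
    then show ?thesis using car by (simp only: eq[symmetric])
  qed
  finally have nx: "h\<^sub>1 * (n + x) = x * h\<^sub>2" .
  have hs: "?h * shear c d m = four_block_mat h\<^sub>1 (h\<^sub>1 * m) (0\<^sub>m d c) h\<^sub>2" if "m \<in> carrier_mat c d" for m
    using c that by (simp add: four_block_mult_shear[of _ c c _ d _ d])
  have "?h * shear c d n * shear c d x = ?h * (shear c d n * shear c d x)"
    using c by (intro assoc_mult_mat[OF _ shear_carrier shear_carrier]) auto
  also have "\<dots> = ?h * shear c d (n + x)" by (simp only: shear_mult[OF n x])
  also have "\<dots> = four_block_mat h\<^sub>1 (x * h\<^sub>2) (0\<^sub>m d c) h\<^sub>2"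
    using hs[of "n + x"] n x by (simp only: nx add_carrier_mat)
  also have "\<dots> = shear c d x * ?h"
    using c x by (simp add: shear_mult_four_block[of _ c c _ d _ d])
  finally have "?h * shear c d n * shear c d x = shear c d x * ?h" .
  moreover have "?h * shear c d n * shear c d x * gl_inv (shear c d x) = ?h * shear c d n"
    by (rule GL_cancel_right(1)[OF shear_GL[OF x], of _ "c + d"])
       (use c in \<open>auto intro: mult_carrier_mat[of _ "c + d" "c + d"]\<close>)
  ultimately show thesis using that[OF shear_GL[OF x]] by simp
qed

theorem theorem1p4:
  fixes \<psi> :: "'a :: {finite, field} \<Rightarrow> complex"
    and \<alpha> :: "nat \<Rightarrow> 'a \<Rightarrow> complex"
    and h\<^sub>1 h\<^sub>2 :: "'a mat"
    and k c\<^sub>1 c\<^sub>2 :: nat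
  assumes "nontrivial_additive_character \<psi>"
    and "k \<ge> 1"
    and "\<And>j. j < k \<Longrightarrow> multiplicative_character (\<alpha> j)"
    and "c\<^sub>1 \<ge> 1" and "c\<^sub>2 \<ge> 1"
    and "h\<^sub>1 \<in> GL c\<^sub>1" and "h\<^sub>2 \<in> GL c\<^sub>2"
    and "\<not> (\<exists>z :: 'a alg_closure. eigenvalue (map_mat to_ac h\<^sub>1) z \<and> eigenvalue (map_mat to_ac h\<^sub>2) z)"
  shows "Kl k \<alpha> \<psi> (four_block_mat h\<^sub>1 (0\<^sub>m c\<^sub>1 c\<^sub>2) (0\<^sub>m c\<^sub>2 c\<^sub>1) h\<^sub>2)
           = of_nat (CARD('a)) ^ ((k - 1) * c\<^sub>1 * c\<^sub>2) * Kl k \<alpha> \<psi> h\<^sub>1 * Kl k \<alpha> \<psi> h\<^sub>2"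
proof -
  \<comment> \<open>The sum of \<open>Kl\<close> over the coset \<open>h U\<close> is evaluated by conjugacy and by \<open>sum_Kl_shear\<close>.\<close>
  let ?h = "four_block_mat h\<^sub>1 (0\<^sub>m c\<^sub>1 c\<^sub>2) (0\<^sub>m c\<^sub>2 c\<^sub>1) h\<^sub>2"
  let ?q = "of_nat CARD('a) :: complex"
  have add: "additive_character \<psi>" using assms(1) by (simp add: nontrivial_additive_character_def)
  note c = GL_carrier[OF assms(6)] GL_carrier[OF assms(7)]
  have h: "?h \<in> GL (c\<^sub>1 + c\<^sub>2)" using c assms(6,7) by (simp add: four_block_upper_GL_iff)
  have "Kl k \<alpha> \<psi> (?h * shear c\<^sub>1 c\<^sub>2 n) = Kl k \<alpha> \<psi> ?h" if n: "n \<in> carrier_mat c\<^sub>1 c\<^sub>2" for n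
  proof -
    obtain p where p: "p \<in> GL (c\<^sub>1 + c\<^sub>2)" "?h * shear c\<^sub>1 c\<^sub>2 n = p * ?h * gl_inv p"
      using block_diag_shear_conj[OF assms(6,7) n assms(8)] .
    show ?thesis unfolding p(2) by (rule Kl_conj[OF add p(1) h])
  qed
  then have "?q ^ (c\<^sub>1 * c\<^sub>2) * Kl k \<alpha> \<psi> ?h = (\<Sum>n\<in>carrier_mat c\<^sub>1 c\<^sub>2. Kl k \<alpha> \<psi> (?h * shear c\<^sub>1 c\<^sub>2 n))"
    by (simp add: card_carrier_mat)
  also have "\<dots> = ?q ^ (k * (c\<^sub>1 * c\<^sub>2)) * Kl k \<alpha> \<psi> h\<^sub>1 * Kl k \<alpha> \<psi> h\<^sub>2"
    using sum_Kl_shear[OF assms(1,3) c(1) zero_carrier_mat zero_carrier_mat c(2) h] by simp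
  also have "k * (c\<^sub>1 * c\<^sub>2) = c\<^sub>1 * c\<^sub>2 + (k - 1) * c\<^sub>1 * c\<^sub>2"
    using assms(2) by (cases k) (auto simp: algebra_simps)
  finally have "?q ^ (c\<^sub>1 * c\<^sub>2) * Kl k \<alpha> \<psi> ?h =
      ?q ^ (c\<^sub>1 * c\<^sub>2) * (?q ^ ((k - 1) * c\<^sub>1 * c\<^sub>2) * Kl k \<alpha> \<psi> h\<^sub>1 * Kl k \<alpha> \<psi> h\<^sub>2)"
    by (simp only: power_add mult.assoc)
  moreover have "?q ^ (c\<^sub>1 * c\<^sub>2) \<noteq> 0" by simp
  ultimately show ?thesis by (metis mult_cancel_left)
qed

end
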